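(* Let $d\ge1$ be an integer, and let $L,\beta,\alpha$ be positive constants. Then there exists a constant $C>0$ such that for any $n\ge1$ and any classifier $\hat f_n:\mathcal Z^n\to\mathcal F$, $$\sup_{P\in\mathcal P'_\Sigma}\big\{\mathbb E R(\hat f_n)-R(f^* )\big\}\ge C\,n^{-\frac{(1+\alpha)\beta}{(2+\alpha)\beta+d}},$$ where $\mathcal P'_\Sigma$ is the class of distributions defined in the context.
   Context: Setting. $(X,Y)$ is a random couple in $\mathcal Z=\mathbb R^d\times\{0,1\}$ with joint distribution $P$; $P_X$ is the marginal of $X$; $\eta(x)=P(Y=1|X=x)$ is the regression function. The sample $(X_1,Y_1),\dots,(X_n,Y_n)$ consists of independent copies of $(X,Y)$. $\mathcal F$ is the set of all decision rules, i.e. Borel functions $f:\mathbb R^d\to\{0,1\}$; the risk of $f$ is $R(f)=P(Y\ne f(X))$, and $f^*(x)=\mathbf 1_{\{\eta(x)\ge1/2\}}$ is the Bayes rule. A classifier $\hat f_n$ is a map from $\mathcal Z^n$ to $\mathcal F$, measurable w.r.t. the sample; $\mathbb E R(\hat f_n)$ is the expectation of $R(\hat f_n)$ over the sample. Margin assumption (MA) with constants $\alpha\ge0$, $C_0>0$: $P_X(0<|\eta(X)-1/2|\le t)\le C_0t^\alpha$ for all $t>0$. Hölder class. $\lfloor\beta\rfloor$ denotes the maximal integer strictly less than $\beta$. $\Sigma(\beta,L,\mathbb R^d)$ is the set of functions $g:\mathbb R^d\to\mathbb R$ that are $\lfloor\beta\rfloor$ times continuously differentiable with $|g(x')-g_x(x')|\le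 L\|x-x'\|^\beta$ for all $x,x'\in\mathbb R^d$, where $g_x(x')=\sum_{|s|\le\lfloor\beta\rfloor}\frac{(x'-x)^s}{s!}D^sg(x)$ is the Taylor polynomial of degree $\lfloor\beta\rfloor$ at $x$ (multi-index notation) and $\|\cdot\|$ is the Euclidean norm. Regular sets. A Lebesgue measurable $A\subset\mathbb R^d$ is $(c_0,r_0)$-regular if $\lambda[A\cap\mathcal B(x,r)]\ge c_0\lambda[\mathcal B(x,r)]$ for all $0<r\le r_0$ and all $x\in A$, where $\lambda$ is Lebesgue measure and $\mathcal B(x,r)$ is the closed Euclidean ball centered at $x$ of radius $r$. Mild density assumption (with $c_0,r_0,\mu_{\max},\mathcal C$): $P_X$ is supported on a compact $(c_0,r_0)$-regular set $A\subseteq\mathcal C$ and has a uniformly bounded density $\mu$ w.r.t. Lebesgue measure: $\mu(x)\le\mu_{\max}$ for all $x\in A$. Class $\mathcal P'_\Sigma$. For a fixed parameter $\alpha\ge0$, fixed positive parameters $c_0,r_0,C_0,\beta,L,\mu_{\max}>0$ and a fixed compact $\mathcal C\subset\mathbb R^d$, $\mathcal P'_\Sigma$ is the class of all probability distributions $P$ on $\mathcal Z$ such that (i) the margin assumption (MA) is satisfied; (ii) $\eta\in\Sigma(\beta,L,\mathbb R^d)$; (iii) the mild density assumption on $P_X$ is satisfied.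
   Formalization: Adds the assumption that some compact (c0,r0)-regular set A contained in C satisfies μmax·λ(A) > 1; without it the class can be empty (e.g. c0 > 1), or, when the largest value is 1, force uniform P_X, and the bound fails. *)

theory Defs
  imports "HOL-Probability.Probability"
begin

definition partial_deriv :: "'n::finite \<Rightarrow> (real^'n \<Rightarrow> real) \<Rightarrow> real^'n \<Rightarrow> real" where
  "partial_deriv i g x = deriv (\<lambda>t. g (x + t *\<^sub>R axis i 1)) 0"

fun cont_diff :: "nat \<Rightarrow> (real^'n::finite \<Rightarrow> real) \<Rightarrow> bool" where
  "cont_diff 0 g \<longleftrightarrow> continuous_on UNIV g"
| "cont_diff (Suc k) g \<longleftrightarrow> continuous_on UNIV g \<and>
     (\<forall>i. (\<forall>x. (\<lambda>t. g (x + t *\<^sub>R axis i 1)) field_differentiable (at 0)) \<and>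
          cont_diff k (partial_deriv i g))"

text \<open>A multi-index is a function \<open>s :: 'n \<Rightarrow> nat\<close>.  The operator \<open>D\<^sup>s\<close> differentiates
  \<open>s i\<close> times in direction \<open>i\<close>; the order of the differentiations is an arbitrary fixed one, which
  is immaterial for the functions it is applied to (\<open>cont_diff k\<close> with \<open>|s| \<le> k\<close>) by Schwarz' theorem.\<close>

definition multi_deriv :: "('n::finite \<Rightarrow> nat) \<Rightarrow> (real^'n \<Rightarrow> real) \<Rightarrow> real^'n \<Rightarrow> real" where
  "multi_deriv s g = foldr partial_deriv (SOME is. \<forall>i. count_list is i = s i) g"

definition taylor_poly :: "nat \<Rightarrow> (real^'n::finite \<Rightarrow> real) \<Rightarrow> real^'n \<Rightarrow> real^'n \<Rightarrow> real" where
  "taylor_poly k g x x' =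
     (\<Sum>s | (\<Sum>i\<in>UNIV. s i) \<le> k.
        (\<Prod>i\<in>UNIV. (x' $ i - x $ i) ^ s i) / (\<Prod>i\<in>UNIV. fact (s i)) * multi_deriv s g x)"

text \<open>The largest integer strictly less than \<open>\<beta> > 0\<close> (so \<open>\<beta> - 1\<close> when \<open>\<beta>\<close> is an integer).\<close>

definition strict_floor :: "real \<Rightarrow> nat" where
  "strict_floor \<beta> = nat (\<lceil>\<beta>\<rceil> - 1)"

definition Hoelder_class :: "real \<Rightarrow> real \<Rightarrow> (real^'n::finite \<Rightarrow> real) set" where
  "Hoelder_class \<beta> L = {g. cont_diff (strict_floor \<beta>) g \<and>
     (\<forall>x x'. \<bar>g x' - taylor_poly (strict_floor \<beta>) g x x'\<bar> \<le> L * norm (x - x') powr \<beta>)}"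

text \<open>The label set \<open>{0,1}\<close> is \<open>bool\<close>, with \<open>1\<close> being \<open>True\<close>.\<close>

definition Z_space :: "((real^'n::finite) \<times> bool) measure" where
  "Z_space = borel \<Otimes>\<^sub>M count_space UNIV"

definition marginal :: "((real^'n::finite) \<times> bool) measure \<Rightarrow> (real^'n) measure" where
  "marginal P = distr P borel fst"

text \<open>\<open>\<eta>\<close> is a version of \<open>x \<mapsto> P(Y = 1 | X = x)\<close>: the random variable \<open>\<eta>(X)\<close> is the conditional
  expectation of the indicator of \<open>Y = 1\<close> given the sigma-algebra generated by \<open>X\<close>.\<close>

definition is_regression ::
    "((real^'n::finite) \<times> bool) measure \<Rightarrow> (real^'n \<Rightarrow> real) \<Rightarrow> bool" where
  "is_regression P \<eta> \<longleftrightarrow> \<eta> \<in> borel_measurable borel \<and> (\<forall>x. 0 \<le> \<eta> x \<and> \<eta> x \<le> 1) \<and>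
     (AE z in P. \<eta> (fst z) =
        real_cond_exp P (vimage_algebra (space P) fst borel) (indicat_real {z. snd z}) z)"

text \<open>An arbitrary version.  It is only used in expressions (the margin assumption and the risk of
  the Bayes rule) whose value is the same for all versions.\<close>

definition regression :: "((real^'n::finite) \<times> bool) measure \<Rightarrow> real^'n \<Rightarrow> real" where
  "regression P = (SOME \<eta>. is_regression P \<eta>)"

definition risk :: "((real^'n::finite) \<times> bool) measure \<Rightarrow> (real^'n \<Rightarrow> bool) \<Rightarrow> real" where
  "risk P f = measure P {z \<in> space P. snd z \<noteq> f (fst z)}"

definition bayes_rule :: "((real^'n::finite) \<times> bool) measure \<Rightarrow> real^'n \<Rightarrow> bool" where
  "bayes_rule P x \<longleftrightarrow> regression P x \<ge> 1/2"

text \<open>Joint measurability in the sample and the point to classify; in particular every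
  \<open>f z\<close> is a Borel decision rule and the risk of \<open>f z\<close> is a measurable function of the sample \<open>z\<close>.\<close>

definition is_classifier ::
    "nat \<Rightarrow> ((nat \<Rightarrow> (real^'n::finite) \<times> bool) \<Rightarrow> real^'n \<Rightarrow> bool) \<Rightarrow> bool" where
  "is_classifier n f \<longleftrightarrow>
     (\<lambda>(z, x). f z x) \<in> (Pi\<^sub>M {..<n} (\<lambda>_. Z_space)) \<Otimes>\<^sub>M borel \<rightarrow>\<^sub>M count_space UNIV"

definition expected_risk :: "nat \<Rightarrow> ((real^'n::finite) \<times> bool) measure \<Rightarrow>
    ((nat \<Rightarrow> (real^'n) \<times> bool) \<Rightarrow> real^'n \<Rightarrow> bool) \<Rightarrow> real" where
  "expected_risk n P f = (\<integral>z. risk P (f z) \<partial>(Pi\<^sub>M {..<n} (\<lambda>_. P)))"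

definition margin_assumption ::
    "real \<Rightarrow> real \<Rightarrow> ((real^'n::finite) \<times> bool) measure \<Rightarrow> bool" where
  "margin_assumption \<alpha> C0 P \<longleftrightarrow>
     (\<forall>t>0. measure (marginal P) {x. 0 < \<bar>regression P x - 1/2\<bar> \<and> \<bar>regression P x - 1/2\<bar> \<le> t}
              \<le> C0 * t powr \<alpha>)"

definition regular_set :: "real \<Rightarrow> real \<Rightarrow> (real^'n::finite) set \<Rightarrow> bool" where
  "regular_set c0 r0 A \<longleftrightarrow> A \<in> sets lebesgue \<and>
     (\<forall>x\<in>A. \<forall>r. 0 < r \<and> r \<le> r0 \<longrightarrow>
        measure lebesgue (A \<inter> cball x r) \<ge> c0 * measure lebesgue (cball x r))"

definition mild_density :: "real \<Rightarrow> real \<Rightarrow> real \<Rightarrow> (real^'n::finite) set \<Rightarrow>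
    ((real^'n) \<times> bool) measure \<Rightarrow> bool" where
  "mild_density c0 r0 \<mu>max K P \<longleftrightarrow>
     (\<exists>A \<mu>. compact A \<and> regular_set c0 r0 A \<and> A \<subseteq> K \<and>
        (AE x in marginal P. x \<in> A) \<and>
        \<mu> \<in> borel_measurable borel \<and> (\<forall>x. 0 \<le> \<mu> x) \<and>
        marginal P = density lborel (\<lambda>x. ennreal (\<mu> x)) \<and>
        (\<forall>x\<in>A. \<mu> x \<le> \<mu>max))"

definition P_Sigma' :: "real \<Rightarrow> real \<Rightarrow> real \<Rightarrow> real \<Rightarrow> real \<Rightarrow> real \<Rightarrow> real \<Rightarrow>
    (real^'n::finite) set \<Rightarrow> ((real^'n) \<times> bool) measure set" where
  "P_Sigma' \<alpha> C0 \<beta> L c0 r0 \<mu>max K =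
     {P. prob_space P \<and> sets P = sets Z_space \<and>
         margin_assumption \<alpha> C0 P \<and>
         (\<exists>\<eta>. is_regression P \<eta> \<and> \<eta> \<in> Hoelder_class \<beta> L) \<and>
         mild_density c0 r0 \<mu>max K P}"

end

(* Fix a regular set A of the required kind and a point of A. At scale delta ~ n^(-1/((2+alpha)beta+d)),
   pack m ~ delta^(-d) well separated points c_j of A close to it. Every sign pattern defines the
   regression function 1/2 + sum_j (+-h) phi((x - c_j)/delta) with h ~ delta^beta, a Hoelder function
   because the bumps have disjoint supports. The marginal puts mass omega ~ delta^(d + alpha beta) on each
   A \<inter> B(c_j, delta/2) and the rest where all bumps vanish: regularity of A keeps the density
   bounded, and the total mass m omega ~ h^alpha gives the margin condition. Since n h^2 omega is bounded,
   two patterns that differ in one sign cannot be told apart from n observations, so averaging over all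
   patterns costs any classifier an excess risk of order m h omega ~ delta^((1+alpha)beta). *)
theory Submission
  imports Defs
begin

section \<open>One-dimensional bumps\<close>

text \<open>The Hoelder class is defined through iterated partial derivatives and multi-index Taylor
  polynomials, so the analytic obstacle is a multivariate remainder bound that is uniform in scale
  and position. The bumps are therefore products over the coordinates of one piecewise polynomial
  profile: every mixed derivative is a product of scalar derivatives, and the remainder comes from
  multiplying scalar expansions. The supports are cubes instead of balls, which only costs factors
  of the dimension. Two patterns that differ at one bump are both compared with the midpoint where
  that bump is removed. There the label is a fair coin on the support of the bump, so the chi-square
  distance is explicit in the integral of the squared bump and factorises over the sample. The scale
  solves n * \<delta>^(2\<beta> + d + \<alpha>\<beta>) ~ 1: the exponents come from h^2, from the
  volume of a cell, and from the factor h^\<alpha> that the margin condition imposes on its mass.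
  The strict inequality \<open>\<mu>max * measure lebesgue A > 1\<close> pays for the ball that is
  reserved for the bumps.\<close>

definition times_differentiable :: "nat \<Rightarrow> (real \<Rightarrow> real) \<Rightarrow> bool" where
  "times_differentiable k u \<longleftrightarrow> (\<forall>j<k. \<forall>t. (deriv ^^ j) u field_differentiable (at t))"

lemma times_differentiable_0 [simp]: "times_differentiable 0 u"
  by (simp add: times_differentiable_def)

text \<open>Peeling off the innermost derivative lets the closure properties below be proved by
  induction on the order with the function generalised.\<close>

lemma times_differentiable_Suc:
  "times_differentiable (Suc k) u \<longleftrightarrow>
     (\<forall>t. u field_differentiable (at t)) \<and> times_differentiable k (deriv u)"
  unfolding times_differentiable_def
  by (simp add: All_less_Suc2 funpow_Suc_right del: funpow.simps(2))

lemma times_differentiable_imp_continuous_on: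
  "times_differentiable (Suc k) u \<Longrightarrow> continuous_on S u"
  by (meson continuous_at_imp_continuous_on field_differentiable_imp_continuous_at times_differentiable_Suc)

lemma times_differentiable_mono:
  "times_differentiable k u \<Longrightarrow> j \<le> k \<Longrightarrow> times_differentiable j u"
  by (simp add: times_differentiable_def)

lemma times_differentiable_const [simp]: "times_differentiable k (\<lambda>_. c)"
  by (induction k arbitrary: c) (simp_all add: times_differentiable_Suc)

lemma times_differentiable_add:
  "times_differentiable k u \<Longrightarrow> times_differentiable k v \<Longrightarrow> times_differentiable k (\<lambda>t. u t + v t)"
proof (induction k arbitrary: u v)
  case (Suc k)
  have "deriv (\<lambda>t. u t + v t) = (\<lambda>t. deriv u t + deriv v t)"
    using Suc.prems by (intro ext deriv_add) (auto simp: times_differentiable_Suc)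
  then show ?case
    using Suc by (auto simp: times_differentiable_Suc intro!: field_differentiable_add)
qed simp

lemma times_differentiable_mult:
  "times_differentiable k u \<Longrightarrow> times_differentiable k v \<Longrightarrow> times_differentiable k (\<lambda>t. u t * v t)"
proof (induction k arbitrary: u v)
  case (Suc k)
  have "deriv (\<lambda>t. u t * v t) = (\<lambda>t. u t * deriv v t + deriv u t * v t)"
    using Suc.prems by (intro ext deriv_mult) (auto simp: times_differentiable_Suc)
  moreover have "times_differentiable k u" "times_differentiable k v"
    using Suc.prems by (auto intro: times_differentiable_mono[of "Suc k"])
  ultimately show ?case
    using Suc by (auto simp: times_differentiable_Suc intro!: times_differentiable_add field_differentiable_mult)
qed simp

lemma deriv_funpow_affine:
  assumes "times_differentiable k u" "j \<le> k"
  shows "(deriv ^^ j) (\<lambda>t. u (a * t + b)) = (\<lambda>t. a ^ j * (deriv ^^ j) u (a * t + b))"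
  using assms(2)
proof (induction j)
  case (Suc j)
  have "((\<lambda>t. a ^ j * (deriv ^^ j) u (a * t + b)) has_real_derivative
          a ^ Suc j * (deriv ^^ Suc j) u (a * t + b)) (at t)" for t
  proof -
    have "(deriv ^^ j) u field_differentiable (at (a * t + b))"
      using assms(1) Suc.prems by (simp add: times_differentiable_def)
    then have "((deriv ^^ j) u has_real_derivative (deriv ^^ Suc j) u (a * t + b)) (at (a * t + b))"
      by (simp add: DERIV_deriv_iff_field_differentiable)
    moreover have "((\<lambda>t. a * t + b) has_real_derivative a) (at t)"
      by (auto intro!: derivative_eq_intros)
    ultimately have "((\<lambda>t. (deriv ^^ j) u (a * t + b)) has_real_derivative
        (deriv ^^ Suc j) u (a * t + b) * a) (at t)"
      by (rule DERIV_chain2)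
    then show ?thesis
      by (auto intro!: derivative_eq_intros)
  qed
  then show ?case
    using Suc by (auto simp: DERIV_imp_deriv)
qed simp

lemma times_differentiable_affine:
  assumes "times_differentiable k u"
  shows "times_differentiable k (\<lambda>t. u (a * t + b))"
  using assms
proof (induction k arbitrary: u)
  case (Suc k)
  have D: "deriv (\<lambda>t. u (a * t + b)) = (\<lambda>t. a * deriv u (a * t + b))"
    using deriv_funpow_affine[OF Suc.prems, of 1] by simp
  have "(\<lambda>t. u (a * t + b)) field_differentiable at t" for t
  proof -
    have "(u \<circ> (\<lambda>t. a * t + b)) field_differentiable at t"
      by (rule field_differentiable_compose)
        (use Suc.prems in \<open>auto simp: times_differentiable_Suc intro!: derivative_intros\<close>)
    then show ?thesis by (simp add: o_def)
  qed
  then show ?case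
    using Suc by (auto simp: times_differentiable_Suc D intro!: times_differentiable_mult)
qed simp

text \<open>Only t = 0 needs an argument: there the difference quotient is at most |h|^(p+1), which
  tends to 0 because the exponent of the truncated power is at least two.\<close>

lemma has_derivative_truncated_power:
  "((\<lambda>t. max 0 t ^ Suc (Suc p)) has_real_derivative real (Suc (Suc p)) * max 0 t ^ Suc p) (at t)"
proof -
  consider "t > 0" | "t < 0" | "t = 0" by linarith
  then show ?thesis
  proof cases
    case 1
    have "((\<lambda>t. t ^ Suc (Suc p)) has_real_derivative real (Suc (Suc p)) * max 0 t ^ Suc p) (at t)"
      using 1 DERIV_pow[of "Suc (Suc p)" t UNIV] by (simp add: max_def)
    then show ?thesis
      by (rule has_field_derivative_transform_within[where d = t]) (use 1 in \<open>auto simp: dist_real_def\<close>)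
  next
    case 2
    have "((\<lambda>t. 0) has_real_derivative real (Suc (Suc p)) * max 0 t ^ Suc p) (at t)"
      using 2 by (auto intro!: derivative_eq_intros)
    then show ?thesis
      by (rule has_field_derivative_transform_within[where d = "-t"]) (use 2 in \<open>auto simp: dist_real_def max_def\<close>)
  next
    case 3
    have "((\<lambda>h. max 0 h ^ Suc (Suc p) / h) \<longlongrightarrow> 0) (at (0::real))"
    proof (rule Lim_null_comparison[where g = "\<lambda>h. \<bar>h\<bar> ^ Suc p"])
      show "\<forall>\<^sub>F h in at (0::real). norm (max 0 h ^ Suc (Suc p) / h) \<le> \<bar>h\<bar> ^ Suc p"
      proof (intro always_eventually allI)
        fix h :: real
        show "norm (max 0 h ^ Suc (Suc p) / h) \<le> \<bar>h\<bar> ^ Suc p"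
        proof (cases "h \<le> 0")
          case True
          then have "max 0 h ^ Suc (Suc p) / h = 0" by (simp add: max_absorb1)
          then show ?thesis by (simp only: norm_zero zero_le_power abs_ge_zero)
        qed (simp add: max_absorb2)
      qed
      show "((\<lambda>h::real. \<bar>h\<bar> ^ Suc p) \<longlongrightarrow> 0) (at 0)"
        by (auto intro!: tendsto_eq_intros)
    qed
    then show ?thesis
      using 3 by (simp add: DERIV_def)
  qed
qed

text \<open>The exponent exceeds the order by one: differentiating k times leaves a multiple of
  \<open>max 0 t\<close>, whose kink at 0 stops the process.\<close>

lemma times_differentiable_truncated_power:
  "times_differentiable k (\<lambda>t. max 0 t ^ Suc k)"
proof (induction k)
  case (Suc k)
  have "deriv (\<lambda>t. max 0 t ^ Suc (Suc k)) = (\<lambda>t::real. real (Suc (Suc k)) * max 0 t ^ Suc k)"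
    using has_derivative_truncated_power by (intro ext DERIV_imp_deriv)
  moreover have "(\<lambda>t::real. max 0 t ^ Suc (Suc k)) field_differentiable at t" for t
    using has_derivative_truncated_power field_differentiable_def by blast
  ultimately show ?case
    unfolding times_differentiable_Suc
    using times_differentiable_mult[OF times_differentiable_const Suc] by presburger
qed simp

text \<open>This is (1 - t^2)^p cut off outside [-1, 1]. Splitting it into two factors puts each
  kink into a single truncated power. Finite smoothness is enough, because the Hoelder condition
  only involves derivatives up to order \<open>strict_floor \<beta>\<close>.\<close>

definition bump :: "nat \<Rightarrow> real \<Rightarrow> real" where
  "bump p t = max 0 (1 - t) ^ p * max 0 (1 + t) ^ p"

lemma times_differentiable_bump: "times_differentiable k (bump (Suc k))"
proof -
  have "bump (Suc k) = (\<lambda>t. max 0 (-1 * t + 1) ^ Suc k * max 0 (1 * t + 1) ^ Suc k)"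
    by (rule ext) (simp add: bump_def algebra_simps)
  then show ?thesis
    using times_differentiable_mult[OF times_differentiable_affine[OF times_differentiable_truncated_power]
        times_differentiable_affine[OF times_differentiable_truncated_power]] by metis
qed

lemma bump_eq_0: "p > 0 \<Longrightarrow> \<bar>t\<bar> \<ge> 1 \<Longrightarrow> bump p t = 0"
  by (auto simp: bump_def max_def power_0_left abs_if split: if_splits)

lemma bump_nonneg: "0 \<le> bump p t"
  by (simp add: bump_def)

lemma bump_eq:
  assumes "\<bar>t\<bar> \<le> 1"
  shows "bump p t = (1 - t\<^sup>2) ^ p"
proof -
  have "max 0 (1 - t) = 1 - t" "max 0 (1 + t) = 1 + t"
    using assms by auto
  moreover have "(1 - t) * (1 + t) = 1 - t\<^sup>2"
    by (simp add: algebra_simps power2_eq_square)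
  ultimately show ?thesis
    by (simp only: bump_def power_mult_distrib[symmetric])
qed

lemma bump_le_1: "bump p t \<le> 1"
proof (cases "\<bar>t\<bar> \<le> 1")
  case True
  then show ?thesis by (auto simp: bump_eq abs_square_le_1 intro!: power_le_one)
next
  case False
  show ?thesis
  proof (cases p)
    case 0
    then show ?thesis by (simp add: bump_def)
  next
    case (Suc q)
    then have "bump p t = 0" using False by (intro bump_eq_0) auto
    then show ?thesis by simp
  qed
qed

text \<open>The marginal will put its mass on points within half the half side of a cube bump; this
  keeps each factor there away from 0, with 3/4 = 1 - (1/2)^2.\<close>

lemma bump_ge: "\<bar>t\<bar> \<le> 1/2 \<Longrightarrow> (3/4) ^ p \<le> bump p t"
proof -
  assume t: "\<bar>t\<bar> \<le> 1/2"
  have "\<bar>t\<bar>\<^sup>2 \<le> (1/2)\<^sup>2"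
    by (rule power_mono[OF t]) simp
  then have "3/4 \<le> 1 - t\<^sup>2"
    by (simp add: power_divide)
  then have "(3/4) ^ p \<le> (1 - t\<^sup>2) ^ p"
    by (rule power_mono) simp
  moreover have "\<bar>t\<bar> \<le> 1"
    using t by linarith
  ultimately show ?thesis
    by (simp only: bump_eq)
qed

text \<open>Outside the closed support the profile vanishes on a neighbourhood, hence so do
  derivatives of every order; at the end points this would restrict j to orders below p.\<close>

lemma deriv_funpow_bump_eq_0:
  assumes "p > 0" "\<bar>t\<bar> > 1"
  shows "(deriv ^^ j) (bump p) t = 0"
  using assms(2)
proof (induction j arbitrary: t)
  case 0
  then show ?case using assms by (simp add: bump_eq_0)
next
  case (Suc j)
  have "((\<lambda>_. 0) has_real_derivative 0) (at t)" by simp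
  then have "((deriv ^^ j) (bump p) has_real_derivative 0) (at t)"
    by (rule has_field_derivative_transform_within[where d = "\<bar>t\<bar> - 1"])
      (use Suc in \<open>auto simp: dist_real_def\<close>)
  then show ?case by (simp add: DERIV_imp_deriv)
qed

text \<open>With exponent k + 3 the derivatives up to order k + 1 are still differentiable, hence
  continuous and bounded on [-1, 1]; outside they vanish. Order k + 1 is the one in the Lagrange
  remainder, and \<open>M \<ge> 1\<close> makes M harmless in product estimates.\<close>

lemma deriv_funpow_bump_bounded:
  obtains M where "M \<ge> 1" "\<And>j t. j \<le> Suc k \<Longrightarrow> \<bar>(deriv ^^ j) (bump (Suc (Suc (Suc k)))) t\<bar> \<le> M"
proof -
  let ?u = "bump (Suc (Suc (Suc k)))"
  have "\<exists>B. \<forall>t. \<bar>(deriv ^^ j) ?u t\<bar> \<le> B" if "j \<le> Suc k" for j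
  proof -
    have "continuous_on {-1..1} ((deriv ^^ j) ?u)"
      using times_differentiable_bump[of "Suc (Suc k)"] that
      by (auto simp: times_differentiable_def intro!: continuous_at_imp_continuous_on
          field_differentiable_imp_continuous_at)
    then have "bounded ((deriv ^^ j) ?u ` {-1..1})"
      by (intro compact_imp_bounded compact_continuous_image) auto
    then obtain B where "\<forall>t\<in>{-1..1}. \<bar>(deriv ^^ j) ?u t\<bar> \<le> B"
      by (auto simp: bounded_iff simp del: atLeastAtMost_iff)
    then have B: "\<And>t. t \<in> {-1..1} \<Longrightarrow> \<bar>(deriv ^^ j) ?u t\<bar> \<le> B"
      by blast
    have "\<bar>(deriv ^^ j) ?u t\<bar> \<le> max B 0" for t
      using deriv_funpow_bump_eq_0[of "Suc (Suc (Suc k))" t j]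
    proof (cases "\<bar>t\<bar> > 1")
      case False
      then have "t \<in> {-1..1}" by auto
      then show ?thesis using B by (simp add: max.coboundedI1)
    qed simp
    then show ?thesis by blast
  qed
  then obtain B where B: "\<And>j t. j \<le> Suc k \<Longrightarrow> \<bar>(deriv ^^ j) ?u t\<bar> \<le> B j"
    by metis
  show thesis
  proof (rule that)
    show "1 + (\<Sum>j\<le>Suc k. \<bar>B j\<bar>) \<ge> 1" by (simp add: sum_nonneg)
    fix j t assume j: "j \<le> Suc k"
    have "\<bar>B j\<bar> \<le> (\<Sum>j\<le>Suc k. \<bar>B j\<bar>)"
      by (rule member_le_sum) (use j in auto)
    then show "\<bar>(deriv ^^ j) ?u t\<bar> \<le> 1 + (\<Sum>j\<le>Suc k. \<bar>B j\<bar>)"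
      using B[OF j, of t] by linarith
  qed
qed

section \<open>Taylor remainders of tensor products\<close>

text \<open>These products are closed under partial derivatives: differentiating in direction i only
  replaces the i-th factor.\<close>

definition tensor :: "('d::finite \<Rightarrow> real \<Rightarrow> real) \<Rightarrow> real^'d \<Rightarrow> real" where
  "tensor U x = (\<Prod>i\<in>UNIV. U i (x $ i))"

text \<open>The argument has the form \<open>1 * t + x $ i\<close> so that the facts about affine
  substitutions apply verbatim.\<close>

lemma tensor_line:
  fixes U :: "'d::finite \<Rightarrow> real \<Rightarrow> real"
  shows "tensor U (x + t *\<^sub>R axis i 1) = U i (1 * t + x $ i) * (\<Prod>l\<in>UNIV - {i}. U l (x $ l))"
  unfolding tensor_def
  by (subst prod.remove[of UNIV i]) (auto simp: axis_def add.commute intro!: prod.cong)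

lemma tensor_line_differentiable:
  assumes "times_differentiable (Suc k) (U i)"
  shows "(\<lambda>t. tensor U (x + t *\<^sub>R axis i 1)) field_differentiable (at t)"
proof -
  have "times_differentiable (Suc k) (\<lambda>t. U i (1 * t + x $ i))"
    by (rule times_differentiable_affine) (rule assms)
  then show ?thesis
    unfolding tensor_line by (intro field_differentiable_mult) (auto simp: times_differentiable_Suc)
qed

lemma partial_deriv_tensor:
  assumes "times_differentiable (Suc k) (U i)"
  shows "partial_deriv i (tensor U) = tensor (U(i := deriv (U i)))"
proof
  fix x
  have D: "times_differentiable (Suc k) (\<lambda>t. U i (1 * t + x $ i))"
    by (rule times_differentiable_affine) (rule assms)
  have "partial_deriv i (tensor U) x = deriv (\<lambda>t. U i (1 * t + x $ i)) 0 * (\<Prod>l\<in>UNIV - {i}. U l (x $ l))"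
    unfolding partial_deriv_def tensor_line using D by (intro deriv_cmult_right) (auto simp: times_differentiable_Suc)
  also have "deriv (\<lambda>t. U i (1 * t + x $ i)) 0 = deriv (U i) (x $ i)"
    using deriv_funpow_affine[OF assms, of 1 1 "x $ i"] by simp
  also have "deriv (U i) (x $ i) * (\<Prod>l\<in>UNIV - {i}. U l (x $ l)) = tensor (U(i := deriv (U i))) x"
    by (simp add: tensor_def prod.remove[of UNIV i])
  finally show "partial_deriv i (tensor U) x = tensor (U(i := deriv (U i))) x" .
qed

lemma continuous_on_tensor:
  assumes "\<And>i. continuous_on UNIV (U i)"
  shows "continuous_on S (tensor U)"
  unfolding tensor_def
  by (intro continuous_intros continuous_on_compose2[OF assms]) auto

text \<open>The extra order of differentiability makes the derivatives of order \<open>k\<close> continuous.\<close>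

lemma cont_diff_tensor:
  assumes "\<And>i. times_differentiable (Suc k) (U i)"
  shows "cont_diff k (tensor U)"
  using assms
proof (induction k arbitrary: U)
  case 0
  then show ?case
    by (auto intro!: continuous_on_tensor times_differentiable_imp_continuous_on)
next
  case (Suc k)
  have "continuous_on UNIV (tensor U)"
    using Suc.prems
    by (auto intro!: continuous_on_tensor times_differentiable_imp_continuous_on)
  moreover have "cont_diff k (partial_deriv i (tensor U))" for i
    unfolding partial_deriv_tensor[OF Suc.prems]
  proof (rule Suc.IH)
    fix j show "times_differentiable (Suc k) ((U(i := deriv (U i))) j)"
      using Suc.prems[of j] times_differentiable_mono[of "Suc (Suc k)" "U j" "Suc k"]
      by (auto simp: times_differentiable_Suc)
  qed
  ultimately show ?case
    using tensor_line_differentiable[where U = U, OF Suc.prems] by simp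
qed

section \<open>Linearity of derivatives and of Taylor remainders\<close>

lemma cont_diff_add:
  "cont_diff k f \<Longrightarrow> cont_diff k g \<Longrightarrow> cont_diff k (\<lambda>x. f x + g x)"
  and partial_deriv_add:
  "cont_diff (Suc k) f \<Longrightarrow> cont_diff (Suc k) g \<Longrightarrow>
     partial_deriv i (\<lambda>x. f x + g x) = (\<lambda>x. partial_deriv i f x + partial_deriv i g x)"
proof -
  \<comment> \<open>\<open>deriv\<close> is additive only where both derivatives exist; this is what
    costs one order of \<open>cont_diff\<close>.\<close>
  have D: "partial_deriv i (\<lambda>x. f x + g x) = (\<lambda>x. partial_deriv i f x + partial_deriv i g x)"
    if "cont_diff (Suc k) f" "cont_diff (Suc k) g" for f g k i
    using that unfolding partial_deriv_def by (intro ext deriv_add) auto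
  then show "cont_diff (Suc k) f \<Longrightarrow> cont_diff (Suc k) g \<Longrightarrow>
     partial_deriv i (\<lambda>x. f x + g x) = (\<lambda>x. partial_deriv i f x + partial_deriv i g x)" .
  show "cont_diff k f \<Longrightarrow> cont_diff k g \<Longrightarrow> cont_diff k (\<lambda>x. f x + g x)"
  proof (induction k arbitrary: f g)
    case (Suc k)
    show ?case
      using Suc.prems Suc.IH
      by (auto simp: D[OF Suc.prems] intro!: continuous_on_add continuous_on_mult_left field_differentiable_add)
  qed (auto intro!: continuous_on_add continuous_on_mult_left)
qed

lemma cont_diff_cmult:
  "cont_diff k f \<Longrightarrow> cont_diff k (\<lambda>x. c * f x)"
  and partial_deriv_cmult:
  "cont_diff (Suc k) f \<Longrightarrow> partial_deriv i (\<lambda>x. c * f x) = (\<lambda>x. c * partial_deriv i f x)"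
proof -
  have D: "partial_deriv i (\<lambda>x. c * f x) = (\<lambda>x. c * partial_deriv i f x)"
    if "cont_diff (Suc k) f" for f k i
    using that unfolding partial_deriv_def by (intro ext deriv_cmult) auto
  then show "cont_diff (Suc k) f \<Longrightarrow> partial_deriv i (\<lambda>x. c * f x) = (\<lambda>x. c * partial_deriv i f x)" .
  show "cont_diff k f \<Longrightarrow> cont_diff k (\<lambda>x. c * f x)"
  proof (induction k arbitrary: f)
    case (Suc k)
    show ?case
      using Suc.prems Suc.IH
      by (auto simp: D[OF Suc.prems] intro!: continuous_on_add continuous_on_mult_left field_differentiable_mult)
  qed (auto intro!: continuous_on_add continuous_on_mult_left)
qed

lemma cont_diff_const: "cont_diff k (\<lambda>_ :: real^'d::finite. c)"
proof (induction k arbitrary: c)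
  case (Suc k)
  have "partial_deriv i (\<lambda>_ :: real^'d. c) = (\<lambda>_. 0)" for i
    by (rule ext) (simp add: partial_deriv_def)
  then show ?case using Suc by simp
qed (auto intro!: continuous_on_add continuous_on_mult_left)

lemma cont_diff_mono: "cont_diff k f \<Longrightarrow> j \<le> k \<Longrightarrow> cont_diff j f"
proof (induction k arbitrary: f j)
  case (Suc k)
  then show ?case by (cases j) auto
qed simp

lemma cont_diff_sum:
  "finite I \<Longrightarrow> (\<And>j. j \<in> I \<Longrightarrow> cont_diff k (f j)) \<Longrightarrow> cont_diff k (\<lambda>x. \<Sum>j\<in>I. f j x)"
  by (induction I rule: finite_induct) (auto intro: cont_diff_const cont_diff_add)

text \<open>The induction starts at the end of the list because \<open>foldr\<close> differentiates
  in the direction of the last entry first; \<open>length is\<close> counts the orders used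
  up.\<close>

lemma foldr_partial_deriv_add:
  "cont_diff (length is) f \<Longrightarrow> cont_diff (length is) g \<Longrightarrow>
    foldr partial_deriv is (\<lambda>x. f x + g x) =
      (\<lambda>x. foldr partial_deriv is f x + foldr partial_deriv is g x)"
proof (induction "is" arbitrary: f g rule: rev_induct)
  case (snoc i "is")
  then show ?case
    by (simp add: partial_deriv_add[of "length is"])
qed simp

lemma foldr_partial_deriv_cmult:
  "cont_diff (length is) f \<Longrightarrow>
    foldr partial_deriv is (\<lambda>x. c * f x) = (\<lambda>x. c * foldr partial_deriv is f x)"
proof (induction "is" arbitrary: f rule: rev_induct)
  case (snoc i "is")
  then show ?case
    by (simp add: partial_deriv_cmult[of "length is"])
qed simp

lemma foldr_partial_deriv_const:
  "foldr partial_deriv is (\<lambda>_. c) = (\<lambda>_. if is = [] then c else 0)"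
proof (induction "is")
  case (Cons i "is")
  then show ?case by (auto simp: partial_deriv_def)
qed simp

text \<open>Each direction acts on its own factor, so only the multiplicities
  \<open>count_list is i\<close> matter: for tensor products the unspecified order in
  \<open>multi_deriv\<close> disappears without an appeal to Schwarz' theorem.\<close>

lemma foldr_partial_deriv_tensor:
  "(\<And>i. times_differentiable (length is) (U i)) \<Longrightarrow>
    foldr partial_deriv is (tensor U) = tensor (\<lambda>i. (deriv ^^ count_list is i) (U i))"
proof (induction "is" arbitrary: U rule: rev_induct)
  case (snoc i "is")
  have P: "partial_deriv i (tensor U) = tensor (U(i := deriv (U i)))"
    by (rule partial_deriv_tensor[of "length is"]) (use snoc.prems in simp)
  have "foldr partial_deriv is (tensor (U(i := deriv (U i)))) =
    tensor (\<lambda>j. (deriv ^^ count_list is j) ((U(i := deriv (U i))) j))"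
  proof (rule snoc.IH)
    fix j show "times_differentiable (length is) ((U(i := deriv (U i))) j)"
      using snoc.prems[of j] times_differentiable_mono[of "Suc (length is)" "U j" "length is"]
      by (auto simp: times_differentiable_Suc)
  qed
  also have "(\<lambda>j. (deriv ^^ count_list is j) ((U(i := deriv (U i))) j)) =
      (\<lambda>j. (deriv ^^ count_list (is @ [i]) j) (U j))"
    by (auto simp: fun_eq_iff funpow_swap1)
  finally show ?case unfolding P[symmetric] by simp
qed simp

text \<open>The choice in \<open>multi_deriv\<close> is from a nonempty set: concatenating s i
  copies of each coordinate i gives a list with the required multiplicities.\<close>

lemma multi_index_list:
  fixes s :: "'d::finite \<Rightarrow> nat"
  obtains "is" where "\<And>f. multi_deriv s f = foldr partial_deriv is f" "\<And>i. count_list is i = s i"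
    "length is = (\<Sum>i\<in>UNIV. s i)"
proof -
  have "\<exists>is. \<forall>i. count_list is i = s i"
  proof -
    obtain xs :: "'d list" where xs: "set xs = UNIV" "distinct xs"
      using finite_distinct_list[OF finite_class.finite_UNIV] by metis
    have count_replicate: "count_list (replicate n a) i = (if i = a then n else 0)" for n and a i :: 'd
      by (induction n) auto
    have "count_list (concat (map (\<lambda>i. replicate (s i) i) ys)) i = (if i \<in> set ys then s i else 0)"
      if "distinct ys" for ys i
      using that by (induction ys) (auto simp: count_replicate)
    then show ?thesis using xs by (metis UNIV_I)
  qed
  then have *: "\<forall>i. count_list (SOME is. \<forall>i. count_list is i = s i) i = s i"
    by (rule someI_ex)
  show thesis
  proof (rule that)
    show "length (SOME is. \<forall>i. count_list is i = s i) = (\<Sum>i\<in>UNIV. s i)"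
      using * sum_count_set[of "SOME is. \<forall>i. count_list is i = s i" UNIV] by simp
  qed (use * in \<open>auto simp: multi_deriv_def\<close>)
qed

text \<open>Every entry is at most the total, so the set lies in a finite box. This matters because
  a sum over an infinite set would be 0 by convention.\<close>

lemma finite_multi_indices: "finite {s :: 'd::finite \<Rightarrow> nat. (\<Sum>i\<in>UNIV. s i) \<le> k}"
proof (rule finite_subset)
  show "{s. (\<Sum>i\<in>UNIV. s i) \<le> k} \<subseteq> PiE (UNIV :: 'd set) (\<lambda>_. {..k})"
    by (auto simp: PiE_UNIV_domain) (meson finite iso_tuple_UNIV_I le_trans member_le_sum zero_le)
qed (auto intro: finite_PiE)

text \<open>The quantity that the Hoelder condition bounds. It is linear in g on
  \<open>cont_diff k\<close>, so a signed sum of bumps can be treated one bump at a time.\<close>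

definition taylor_remainder :: "nat \<Rightarrow> (real^'d::finite \<Rightarrow> real) \<Rightarrow> real^'d \<Rightarrow> real^'d \<Rightarrow> real" where
  "taylor_remainder k g x x' = g x' - taylor_poly k g x x'"

lemma taylor_remainder_add:
  assumes "cont_diff k f" "cont_diff k g"
  shows "taylor_remainder k (\<lambda>x. f x + g x) x x' = taylor_remainder k f x x' + taylor_remainder k g x x'"
proof -
  have "multi_deriv s (\<lambda>x. f x + g x) x = multi_deriv s f x + multi_deriv s g x"
    if "(\<Sum>i\<in>UNIV. s i) \<le> k" for s
  proof -
    obtain "is" where "is": "\<And>f. multi_deriv s f = foldr partial_deriv is f" "length is = (\<Sum>i\<in>UNIV. s i)"
      using multi_index_list by metis
    then show ?thesis
      using assms that by (simp add: foldr_partial_deriv_add cont_diff_mono)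
  qed
  then show ?thesis
    by (simp add: taylor_remainder_def taylor_poly_def distrib_left sum.distrib)
qed

lemma taylor_remainder_cmult:
  assumes "cont_diff k f"
  shows "taylor_remainder k (\<lambda>x. c * f x) x x' = c * taylor_remainder k f x x'"
proof -
  have "multi_deriv s (\<lambda>x. c * f x) x = c * multi_deriv s f x"
    if "(\<Sum>i\<in>UNIV. s i) \<le> k" for s
  proof -
    obtain "is" where "is": "\<And>f. multi_deriv s f = foldr partial_deriv is f" "length is = (\<Sum>i\<in>UNIV. s i)"
      using multi_index_list by metis
    then show ?thesis
      using assms that by (simp add: foldr_partial_deriv_cmult cont_diff_mono)
  qed
  then show ?thesis
    by (simp add: taylor_remainder_def taylor_poly_def right_diff_distrib sum_distrib_left mult.left_commute)
qed

lemma taylor_remainder_const: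
  fixes x :: "real^'d::finite"
  shows "taylor_remainder k (\<lambda>_. c) x x' = 0"
proof -
  have *: "multi_deriv s (\<lambda>_. c) x = (if s = (\<lambda>_. 0) then c else 0)" for s :: "'d \<Rightarrow> nat"
  proof -
    obtain "is" where "is": "\<And>f. multi_deriv s f = foldr partial_deriv is f" "length is = (\<Sum>i\<in>UNIV. s i)"
      using multi_index_list by metis
    then have "is = [] \<longleftrightarrow> s = (\<lambda>_. 0)"
      by (metis finite length_0_conv sum_eq_0_iff iso_tuple_UNIV_I ext)
    then show ?thesis
      by (simp add: "is" foldr_partial_deriv_const)
  qed
  have "taylor_poly k (\<lambda>_. c) x x' =
     (\<Sum>s :: 'd \<Rightarrow> nat | (\<Sum>i\<in>UNIV. s i) \<le> k. if s = (\<lambda>_. 0) then c else 0)"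
    unfolding taylor_poly_def * by (intro sum.cong) auto
  also have "\<dots> = c"
    using finite_multi_indices by (subst sum.delta) auto
  finally show ?thesis by (simp add: taylor_remainder_def)
qed

lemma taylor_remainder_sum:
  "finite I \<Longrightarrow> (\<And>j. j \<in> I \<Longrightarrow> cont_diff k (f j)) \<Longrightarrow>
    taylor_remainder k (\<lambda>x. \<Sum>j\<in>I. f j x) x x' = (\<Sum>j\<in>I. taylor_remainder k (f j) x x')"
  by (induction I rule: finite_induct)
    (auto simp: taylor_remainder_const taylor_remainder_add cont_diff_sum)

text \<open>Maclaurin's formula with Lagrange remainder, applied to the function shifted by y; the
  factor 1/(k+1)! is dropped since only the order in h matters.\<close>

lemma taylor_1D_bound:
  assumes u: "times_differentiable (Suc k) u" and M: "\<And>t. \<bar>(deriv ^^ Suc k) u t\<bar> \<le> M"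
  shows "\<bar>u (y + h) - (\<Sum>j\<le>k. (deriv ^^ j) u y / fact j * h ^ j)\<bar> \<le> M * \<bar>h\<bar> ^ Suc k"
proof -
  have "((\<lambda>t. (deriv ^^ m) u (y + t)) has_real_derivative (deriv ^^ Suc m) u (y + t)) (at t)"
    if "m < Suc k" for m t
  proof -
    have "((deriv ^^ m) u has_real_derivative (deriv ^^ Suc m) u (y + t)) (at (y + t))"
      using u that by (simp add: times_differentiable_def DERIV_deriv_iff_field_differentiable)
    then show ?thesis
      by (simp add: DERIV_shift add.commute)
  qed
  then obtain t where "u (y + h) = (\<Sum>m<Suc k. (deriv ^^ m) u (y + 0) / fact m * h ^ m) +
      (deriv ^^ Suc k) u (y + t) / fact (Suc k) * h ^ Suc k"
    using Maclaurin_bi_le[of "\<lambda>m t. (deriv ^^ m) u (y + t)" "\<lambda>t. u (y + t)" "Suc k" h] by auto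
  then have "\<bar>u (y + h) - (\<Sum>j\<le>k. (deriv ^^ j) u y / fact j * h ^ j)\<bar> =
      \<bar>(deriv ^^ Suc k) u (y + t)\<bar> / fact (Suc k) * \<bar>h\<bar> ^ Suc k"
    by (simp add: lessThan_Suc_atMost abs_mult power_abs del: fact_Suc funpow.simps power_Suc)
  also have "\<dots> \<le> M * \<bar>h\<bar> ^ Suc k"
  proof (rule mult_right_mono)
    have "\<bar>(deriv ^^ Suc k) u (y + t)\<bar> / fact (Suc k) \<le> \<bar>(deriv ^^ Suc k) u (y + t)\<bar> / 1"
      by (rule divide_left_mono) (auto intro: fact_ge_1 simp del: fact_Suc)
    then show "\<bar>(deriv ^^ Suc k) u (y + t)\<bar> / fact (Suc k) \<le> M"
      using M[of "y + t"] by linarith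
  qed simp
  finally show ?thesis .
qed

text \<open>Dividing by N brings all factors into [-1, 1], where a product changes by at most the
  sum of the changes of its factors.\<close>

lemma abs_prod_diff_le:
  fixes v w :: "'i \<Rightarrow> real"
  assumes "\<And>i. i \<in> I \<Longrightarrow> \<bar>v i\<bar> \<le> N" "\<And>i. i \<in> I \<Longrightarrow> \<bar>w i\<bar> \<le> N" "N \<ge> 1"
    and "\<And>i. i \<in> I \<Longrightarrow> \<bar>v i - w i\<bar> \<le> e"
  shows "\<bar>(\<Prod>i\<in>I. v i) - (\<Prod>i\<in>I. w i)\<bar> \<le> N ^ card I * (real (card I) * e)"
proof -
  have N: "N > 0" using assms by linarith
  have eq: "(\<Prod>i\<in>I. z i) = N ^ card I * (\<Prod>i\<in>I. z i / N)" for z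
    using N by (simp add: prod_dividef)
  have "\<bar>(\<Prod>i\<in>I. v i / N) - (\<Prod>i\<in>I. w i / N)\<bar> \<le> (\<Sum>i\<in>I. \<bar>v i / N - w i / N\<bar>)"
    using norm_prod_diff[of I "\<lambda>i. v i / N" "\<lambda>i. w i / N"] assms N by simp
  also have "\<dots> \<le> (\<Sum>i\<in>I. e)"
  proof (rule sum_mono)
    fix i assume i: "i \<in> I"
    have "\<bar>v i / N - w i / N\<bar> = \<bar>v i - w i\<bar> / N"
      using N by (simp add: diff_divide_distrib[symmetric])
    also have "\<dots> \<le> \<bar>v i - w i\<bar> / 1"
      using assms(3) by (intro divide_left_mono) auto
    finally show "\<bar>v i / N - w i / N\<bar> \<le> e"
      using assms(4)[OF i] by simp
  qed
  finally have "\<bar>(\<Prod>i\<in>I. v i / N) - (\<Prod>i\<in>I. w i / N)\<bar> \<le> real (card I) * e"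
    by simp
  then have "N ^ card I * \<bar>(\<Prod>i\<in>I. v i / N) - (\<Prod>i\<in>I. w i / N)\<bar> \<le> N ^ card I * (real (card I) * e)"
    using N by (intro mult_left_mono) auto
  then show ?thesis
    using N by (simp only: eq[of v] eq[of w] right_diff_distrib[symmetric] abs_mult abs_of_pos zero_less_power)
qed

text \<open>Multiplying one-dimensional Taylor expansions: the surplus terms have total degree above \<open>k\<close>.\<close>

lemma truncated_product_bound:
  fixes v h :: "'d::finite \<Rightarrow> real" and a :: "'d \<Rightarrow> nat \<Rightarrow> real"
  assumes M: "M \<ge> 1" and v: "\<And>i. \<bar>v i\<bar> \<le> M" and a: "\<And>i j. j \<le> k \<Longrightarrow> \<bar>a i j\<bar> \<le> M"
    and h: "\<And>i. \<bar>h i\<bar> \<le> r"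
    and rem: "\<And>i. \<bar>v i - (\<Sum>j\<le>k. a i j * h i ^ j)\<bar> \<le> M * \<bar>h i\<bar> ^ Suc k"
  shows "\<bar>(\<Prod>i\<in>UNIV. v i) - (\<Sum>s | (\<Sum>i\<in>UNIV. s i) \<le> k. \<Prod>i\<in>UNIV. a i (s i) * h i ^ s i)\<bar>
    \<le> (((real k + 1) * M) ^ CARD('d) * (real CARD('d) * M) + ((real k + 1) * M) ^ CARD('d))
        * (if r \<le> 1 then r ^ Suc k else r ^ k)"
    (is "\<bar>?V - ?T\<bar> \<le> (?N ^ _ * _ + _) * _")
proof -
  define c where "c s = (\<Prod>i\<in>UNIV. a i (s i) * h i ^ s i)" for s :: "'d \<Rightarrow> nat"
  \<comment> \<open>Expanding the product of the scalar polynomials produces all multi-indices with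
    entries at most k; the Taylor polynomial keeps only those in \<open>S\<close>, defined
    next.\<close>
  define E where "E = PiE (UNIV :: 'd set) (\<lambda>_. {..k})"
  define S where "S = {s :: 'd \<Rightarrow> nat. (\<Sum>i\<in>UNIV. s i) \<le> k}"
  define P where "P = (\<Prod>i\<in>UNIV. \<Sum>j\<le>k. a i j * h i ^ j)"
  have r: "r \<ge> 0" using h[of undefined] by linarith
  have SE: "S \<subseteq> E"
    unfolding S_def E_def
    by (auto simp: PiE_UNIV_domain) (meson finite iso_tuple_UNIV_I le_trans member_le_sum zero_le)
  have finE: "finite E" by (simp add: E_def finite_PiE)
  have cardE: "card E = (k + 1) ^ CARD('d)" by (simp add: E_def card_PiE)
  have PE: "P = (\<Sum>s\<in>E. c s)"
    unfolding P_def E_def c_def by (subst prod_sum_PiE) auto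
  have c_le: "\<bar>c s\<bar> \<le> M ^ CARD('d) * r ^ (\<Sum>i\<in>UNIV. s i)" if "s \<in> E" for s
  proof -
    have "\<bar>c s\<bar> = (\<Prod>i\<in>UNIV. \<bar>a i (s i)\<bar> * \<bar>h i\<bar> ^ s i)"
      by (simp add: c_def abs_prod abs_mult power_abs)
    also have "\<dots> \<le> (\<Prod>i\<in>(UNIV::'d set). M * r ^ s i)"
      using that M h a r
      by (intro prod_mono conjI mult_mono power_mono mult_nonneg_nonneg) (auto simp: E_def PiE_iff)
    also have "\<dots> = M ^ CARD('d) * r ^ (\<Sum>i\<in>UNIV. s i)"
      by (simp add: prod.distrib power_sum)
    finally show ?thesis .
  qed
  \<comment> \<open>Serves both regimes: F will be the set of surplus terms when r is small, and the
    index set of the Taylor polynomial itself when r is large.\<close>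
  have sum_c_le: "\<bar>\<Sum>s\<in>F. c s\<bar> \<le> ?N ^ CARD('d) * e"
    if F: "F \<subseteq> E" and e: "e \<ge> 0" "\<And>s. s \<in> F \<Longrightarrow> r ^ (\<Sum>i\<in>UNIV. s i) \<le> e" for F e
  proof -
    have "\<bar>\<Sum>s\<in>F. c s\<bar> \<le> (\<Sum>s\<in>F. M ^ CARD('d) * e)"
    proof (rule order_trans[OF sum_abs], rule sum_mono)
      fix s assume s: "s \<in> F"
      have "M ^ CARD('d) * r ^ (\<Sum>i\<in>UNIV. s i) \<le> M ^ CARD('d) * e"
        using M e(2)[OF s] by (intro mult_left_mono) auto
      then show "\<bar>c s\<bar> \<le> M ^ CARD('d) * e"
        using c_le s F by fastforce
    qed
    also have "\<dots> = real (card F) * (M ^ CARD('d) * e)" by simp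
    also have "\<dots> \<le> real (card E) * (M ^ CARD('d) * e)"
      using M e F finE by (intro mult_right_mono) (auto intro: card_mono)
    also have "\<dots> = ?N ^ CARD('d) * e"
      by (simp add: cardE power_mult_distrib add.commute)
    finally show ?thesis .
  qed
  have T: "?T = (\<Sum>s\<in>S. c s)" by (simp add: S_def c_def)
  have N1: "?N \<ge> 1"
    using M mult_mono[of 1 "real k + 1" 1 M] by simp
  have MN: "M \<le> ?N" using M by (simp add: algebra_simps)
  show ?thesis
  proof (cases "r \<le> 1")
    case True
    have p_le: "\<bar>\<Sum>j\<le>k. a i j * h i ^ j\<bar> \<le> ?N" for i
    proof -
      have "\<bar>\<Sum>j\<le>k. a i j * h i ^ j\<bar> \<le> (\<Sum>j\<le>k. M)"
      proof (rule order_trans[OF sum_abs], rule sum_mono)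
        fix j assume "j \<in> {..k}"
        have "\<bar>h i\<bar> ^ j \<le> 1" using True h[of i] by (intro power_le_one) auto
        then have "\<bar>a i j\<bar> * \<bar>h i\<bar> ^ j \<le> M * 1"
          using M a \<open>j \<in> {..k}\<close> by (intro mult_mono) auto
        then show "\<bar>a i j * h i ^ j\<bar> \<le> M" by (simp add: abs_mult power_abs)
      qed
      then show ?thesis by (simp add: add.commute)
    qed
    have "\<bar>?V - P\<bar> \<le> ?N ^ card (UNIV::'d set) * (real (card (UNIV::'d set)) * (M * r ^ Suc k))"
      unfolding P_def
    proof (rule abs_prod_diff_le)
      fix i
      show "\<bar>v i - (\<Sum>j\<le>k. a i j * h i ^ j)\<bar> \<le> M * r ^ Suc k"
        using M by (intro order_trans[OF rem] mult_left_mono power_mono h) auto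
    qed (use v MN N1 p_le in \<open>auto intro: order_trans\<close>)
    moreover have "\<bar>P - ?T\<bar> \<le> ?N ^ CARD('d) * r ^ Suc k"
    proof -
      have "P - ?T = (\<Sum>s\<in>E - S. c s)"
        unfolding PE T using SE finE by (simp add: sum_diff)
      moreover have "\<bar>\<Sum>s\<in>E - S. c s\<bar> \<le> ?N ^ CARD('d) * r ^ Suc k"
        by (rule sum_c_le) (use True r in \<open>auto simp: S_def simp del: power_Suc intro!: power_decreasing\<close>)
      ultimately show ?thesis by simp
    qed
    ultimately have "\<bar>?V - ?T\<bar> \<le> ?N ^ CARD('d) * (real CARD('d) * (M * r ^ Suc k)) + ?N ^ CARD('d) * r ^ Suc k"
      by linarith
    also have "\<dots> = (?N ^ CARD('d) * (real CARD('d) * M) + ?N ^ CARD('d)) * r ^ Suc k"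
      by (simp add: algebra_simps)
    finally show ?thesis using True by simp
  next
    case False
    \<comment> \<open>For r > 1 no cancellation is used: both terms are bounded separately, and r^k
      dominates every power of degree at most k.\<close>
    have "\<bar>?V\<bar> \<le> M ^ CARD('d)"
      using prod_mono[of UNIV "\<lambda>i. \<bar>v i\<bar>" "\<lambda>_. M"] v by (simp add: abs_prod)
    also have "\<dots> \<le> ?N ^ CARD('d) * (real CARD('d) * M)"
    proof -
      have "M ^ CARD('d) * 1 \<le> ?N ^ CARD('d) * (real CARD('d) * M)"
      proof (rule mult_mono)
        show "M ^ CARD('d) \<le> ?N ^ CARD('d)" using MN M by (intro power_mono) auto
        show "1 \<le> real CARD('d) * M" using M mult_mono[of 1 "real CARD('d)" 1 M] by simp
      qed (use N1 in auto)
      then show ?thesis by simp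
    qed
    also have "\<dots> \<le> ?N ^ CARD('d) * (real CARD('d) * M) * r ^ k"
    proof -
      have "1 \<le> r ^ k" using False by (intro one_le_power) auto
      then show ?thesis
        using M N1 mult_left_mono[of 1 "r ^ k" "?N ^ CARD('d) * (real CARD('d) * M)"] by simp
    qed
    finally have "\<bar>?V\<bar> \<le> ?N ^ CARD('d) * (real CARD('d) * M) * r ^ k" .
    moreover have "\<bar>?T\<bar> \<le> ?N ^ CARD('d) * r ^ k"
      unfolding T by (rule sum_c_le) (use False SE in \<open>auto simp: S_def intro!: power_increasing\<close>)
    ultimately have "\<bar>?V - ?T\<bar> \<le> ?N ^ CARD('d) * (real CARD('d) * M) * r ^ k + ?N ^ CARD('d) * r ^ k"
      by linarith
    also have "\<dots> = (?N ^ CARD('d) * (real CARD('d) * M) + ?N ^ CARD('d)) * r ^ k"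
      by (simp add: algebra_simps)
    finally show ?thesis using False by simp
  qed
qed

text \<open>The powers of a from the chain rule join the increments, so the remainder is that of the
  unscaled profile between the points a * x + b and a * x' + b.\<close>

lemma taylor_remainder_tensor_affine:
  fixes x x' :: "real^'d::finite"
  assumes u: "times_differentiable k u"
  shows "taylor_remainder k (tensor (\<lambda>i t. u (a * t + b i))) x x' =
    (\<Prod>i\<in>UNIV. u (a * x' $ i + b i)) -
    (\<Sum>s | (\<Sum>i\<in>UNIV. s i) \<le> k. \<Prod>i\<in>UNIV.
       (deriv ^^ s i) u (a * x $ i + b i) / fact (s i) * (a * (x' $ i - x $ i)) ^ s i)"
proof -
  have "multi_deriv s (tensor (\<lambda>i t. u (a * t + b i))) x =
      (\<Prod>i\<in>UNIV. a ^ s i * (deriv ^^ s i) u (a * x $ i + b i))"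
    if s: "(\<Sum>i\<in>UNIV. s i) \<le> k" for s
  proof -
    obtain "is" where "is": "\<And>f. multi_deriv s f = foldr partial_deriv is f"
      "\<And>i. count_list is i = s i" "length is = (\<Sum>i\<in>UNIV. s i)"
      using multi_index_list by metis
    have "times_differentiable (length is) (\<lambda>t. u (a * t + b i))" for i
      using "is"(3) s times_differentiable_mono[OF u] by (intro times_differentiable_affine) auto
    then have "multi_deriv s (tensor (\<lambda>i t. u (a * t + b i))) x =
        (\<Prod>i\<in>UNIV. (deriv ^^ s i) (\<lambda>t. u (a * t + b i)) (x $ i))"
      by (simp add: "is" foldr_partial_deriv_tensor tensor_def)
    also have "\<dots> = (\<Prod>i\<in>UNIV. a ^ s i * (deriv ^^ s i) u (a * x $ i + b i))"
    proof (rule prod.cong)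
      fix i
      have "s i \<le> k" using s by (meson finite iso_tuple_UNIV_I le_trans member_le_sum zero_le)
      then show "(deriv ^^ s i) (\<lambda>t. u (a * t + b i)) (x $ i) = a ^ s i * (deriv ^^ s i) u (a * x $ i + b i)"
        by (simp add: deriv_funpow_affine[OF u])
    qed simp
    finally show ?thesis .
  qed
  then have "taylor_poly k (tensor (\<lambda>i t. u (a * t + b i))) x x' =
    (\<Sum>s | (\<Sum>i\<in>UNIV. s i) \<le> k. (\<Prod>i\<in>UNIV. (x' $ i - x $ i) ^ s i) / (\<Prod>i\<in>UNIV. fact (s i)) *
      (\<Prod>i\<in>UNIV. a ^ s i * (deriv ^^ s i) u (a * x $ i + b i)))"
    unfolding taylor_poly_def by (intro sum.cong) auto
  also have "\<dots> = (\<Sum>s | (\<Sum>i\<in>UNIV. s i) \<le> k. \<Prod>i\<in>UNIV.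
       (deriv ^^ s i) u (a * x $ i + b i) / fact (s i) * (a * (x' $ i - x $ i)) ^ s i)"
    by (intro sum.cong) (simp_all add: prod_dividef[symmetric] prod.distrib[symmetric] power_mult_distrib mult_ac)
  finally show ?thesis
    by (simp add: taylor_remainder_def tensor_def)
qed

section \<open>Cube bumps at arbitrary scale and position\<close>

text \<open>Supported on the cube with centre \<open>- b / a\<close> and half side \<open>1 / a\<close>.\<close>

definition cube_bump :: "nat \<Rightarrow> real \<Rightarrow> real^'d::finite \<Rightarrow> real^'d \<Rightarrow> real" where
  "cube_bump p a b = tensor (\<lambda>i t. bump p (a * t + b $ i))"

lemma cont_diff_cube_bump: "cont_diff k (cube_bump (Suc (Suc k)) a b)"
  unfolding cube_bump_def
  by (intro cont_diff_tensor times_differentiable_affine times_differentiable_bump)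

lemma cube_bump_nonneg: "0 \<le> cube_bump p a b x"
  by (simp add: cube_bump_def tensor_def prod_nonneg bump_nonneg)

lemma cube_bump_le_1: "cube_bump p a b x \<le> 1"
  by (simp add: cube_bump_def tensor_def prod_le_1 bump_nonneg bump_le_1)

lemma cube_bump_eq_0: "p > 0 \<Longrightarrow> \<bar>a * x $ i + b $ i\<bar> \<ge> 1 \<Longrightarrow> cube_bump p a b x = 0"
  unfolding cube_bump_def tensor_def by (rule prod_zero) (auto intro: bump_eq_0)

lemma cube_bump_ge:
  fixes x :: "real^'d::finite"
  assumes "\<And>i. \<bar>a * x $ i + b $ i\<bar> \<le> 1/2"
  shows "(3/4) ^ (p * CARD('d)) \<le> cube_bump p a b x"
proof -
  have "(\<Prod>i\<in>(UNIV::'d set). (3/4) ^ p) \<le> cube_bump p a b x"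
    unfolding cube_bump_def tensor_def using bump_ge assms by (intro prod_mono) auto
  then show ?thesis by (simp add: power_mult)
qed

text \<open>Since k < \<beta> \<le> k + 1, the power r^\<beta> dominates r^(k+1) for r \<le> 1 and
  r^k for r > 1, which turns the two-regime estimate for products into a Hoelder bound. Scale and
  centre enter only through \<open>a * norm (x - x')\<close>, so one C serves all bumps.\<close>

lemma taylor_remainder_cube_bump_bound:
  fixes \<beta> :: real
  assumes "real k < \<beta>" "\<beta> \<le> real k + 1"
  obtains C where "C > 0" "\<And>a b (x :: real^'d::finite) x'. a > 0 \<Longrightarrow>
    \<bar>taylor_remainder k (cube_bump (Suc (Suc (Suc k))) a b) x x'\<bar> \<le> C * (a * norm (x - x')) powr \<beta>"
proof -
  define u where "u = bump (Suc (Suc (Suc k)))"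
  have u: "times_differentiable (Suc (Suc k)) u" "times_differentiable (Suc k) u" "times_differentiable k u"
    using times_differentiable_mono[OF times_differentiable_bump[of "Suc (Suc k)"]] by (auto simp: u_def)
  obtain M where M: "M \<ge> 1" "\<And>j t. j \<le> Suc k \<Longrightarrow> \<bar>(deriv ^^ j) u t\<bar> \<le> M"
    using deriv_funpow_bump_bounded[of k] unfolding u_def by metis
  define C where "C = ((real k + 1) * M) ^ CARD('d) * (real CARD('d) * M) + ((real k + 1) * M) ^ CARD('d)"
  have "C > 0" unfolding C_def using M by (intro add_nonneg_pos) auto
  moreover have "\<bar>taylor_remainder k (cube_bump (Suc (Suc (Suc k))) a b) x x'\<bar> \<le> C * (a * norm (x - x')) powr \<beta>"
    if a: "a > 0" for a b and x x' :: "real^'d"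
  proof -
    define r where "r = a * norm (x - x')"
    have r: "r \<ge> 0" using a by (simp add: r_def)
    have "\<bar>taylor_remainder k (cube_bump (Suc (Suc (Suc k))) a b) x x'\<bar> \<le> C * (if r \<le> 1 then r ^ Suc k else r ^ k)"
      unfolding cube_bump_def u_def[symmetric] taylor_remainder_tensor_affine[OF u(3)] C_def
    proof (rule truncated_product_bound)
      fix i
      show "\<bar>u (a * x' $ i + b $ i)\<bar> \<le> M" using M(2)[of 0] by simp
      have "\<bar>x' $ i - x $ i\<bar> \<le> norm (x' - x)" using component_le_norm_cart[of "x' - x" i] by simp
      then show "\<bar>a * (x' $ i - x $ i)\<bar> \<le> r"
        using a by (simp add: r_def abs_mult norm_minus_commute)
      have "u (a * x' $ i + b $ i) = u ((a * x $ i + b $ i) + a * (x' $ i - x $ i))"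
        by (simp add: algebra_simps)
      then show "\<bar>u (a * x' $ i + b $ i) - (\<Sum>j\<le>k. (deriv ^^ j) u (a * x $ i + b $ i) / fact j * (a * (x' $ i - x $ i)) ^ j)\<bar>
          \<le> M * \<bar>a * (x' $ i - x $ i)\<bar> ^ Suc k"
        using taylor_1D_bound[OF u(2), of M "a * x $ i + b $ i" "a * (x' $ i - x $ i)"] M(2)[of "Suc k"] by simp
    next
      fix i j assume "j \<le> k"
      have "\<bar>(deriv ^^ j) u (a * x $ i + b $ i)\<bar> / fact j \<le> \<bar>(deriv ^^ j) u (a * x $ i + b $ i)\<bar> / 1"
        by (rule divide_left_mono) (auto intro: fact_ge_1)
      also have "\<dots> \<le> M" using M(2)[of j] \<open>j \<le> k\<close> by simp
      finally show "\<bar>(deriv ^^ j) u (a * x $ i + b $ i) / fact j\<bar> \<le> M" by simp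
    qed (rule M)
    also have "\<dots> \<le> C * r powr \<beta>"
    proof (rule mult_left_mono)
      show "(if r \<le> 1 then r ^ Suc k else r ^ k) \<le> r powr \<beta>"
      proof (cases "r = 0")
        case False
        then have "r > 0" using r by simp
        then have *: "r ^ m = r powr real m" for m by (simp add: powr_realpow)
        show ?thesis
          unfolding *
        proof (cases "r \<le> 1")
          case True
          then have "r powr real (Suc k) \<le> r powr \<beta>"
            using \<open>r > 0\<close> assms by (intro powr_mono') auto
          then show "(if r \<le> 1 then r powr real (Suc k) else r powr real k) \<le> r powr \<beta>"
            using True by simp
        next
          case False
          then have "r powr real k \<le> r powr \<beta>"
            using assms by (intro powr_mono) auto
          then show "(if r \<le> 1 then r powr real (Suc k) else r powr real k) \<le> r powr \<beta>"
            using False by simp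
        qed
      qed simp
    qed (use \<open>C > 0\<close> in simp)
    finally show ?thesis by (simp add: r_def)
  qed
  ultimately show thesis by (rule that)
qed

text \<open>A point x outside the closed cube kills all derivatives in the Taylor polynomial, a
  point x' outside it kills the value; the offending coordinates may differ.\<close>

lemma taylor_remainder_cube_bump_eq_0:
  fixes x x' :: "real^'d::finite"
  assumes "k \<le> p" "\<bar>a * x $ i + b $ i\<bar> > 1" "\<bar>a * x' $ j + b $ j\<bar> > 1"
  shows "taylor_remainder k (cube_bump (Suc p) a b) x x' = 0"
proof -
  have "(\<Prod>i\<in>UNIV. bump (Suc p) (a * x' $ i + b $ i)) = 0"
    by (intro prod_zero bexI[of _ j] bump_eq_0) (use assms in auto)
  moreover have "(\<Prod>i\<in>UNIV. (deriv ^^ s i) (bump (Suc p)) (a * x $ i + b $ i) / fact (s i) *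
      (a * (x' $ i - x $ i)) ^ s i) = 0" for s
    by (intro prod_zero bexI[of _ i]) (use assms in \<open>auto simp: deriv_funpow_bump_eq_0\<close>)
  moreover have "times_differentiable k (bump (Suc p))"
    by (rule times_differentiable_mono[OF times_differentiable_bump assms(1)])
  ultimately show ?thesis
    by (simp only: cube_bump_def taylor_remainder_tensor_affine sum.neutral_const diff_zero)
qed

text \<open>At most two bumps contribute to the Taylor remainder at a given pair of points.\<close>

lemma bump_combination_in_Hoelder_class:
  fixes \<beta> :: real
  assumes "\<beta> > 0"
  obtains C where "C > 0" "\<And>(I :: 'j set) a b w h c L. \<lbrakk>finite I; a > 0; h \<ge> 0; \<And>j. j \<in> I \<Longrightarrow> \<bar>w j\<bar> \<le> h;
     \<And>j l x. \<lbrakk>j \<in> I; l \<in> I; \<And>i. \<bar>a * x $ i + b j $ i\<bar> \<le> 1; \<And>i. \<bar>a * x $ i + b l $ i\<bar> \<le> 1\<rbrakk> \<Longrightarrow> j = l;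
     C * h * a powr \<beta> \<le> L\<rbrakk> \<Longrightarrow>
     (\<lambda>x :: real^'d::finite. c + (\<Sum>j\<in>I. w j * cube_bump (strict_floor \<beta> + 3) a (b j) x)) \<in> Hoelder_class \<beta> L"
proof -
  define k where "k = strict_floor \<beta>"
  have k: "real k < \<beta>" "\<beta> \<le> real k + 1"
    unfolding k_def strict_floor_def using assms by linarith+
  obtain C where C: "C > 0" "\<And>a b (x :: real^'d) x'. a > 0 \<Longrightarrow>
    \<bar>taylor_remainder k (cube_bump (Suc (Suc (Suc k))) a b) x x'\<bar> \<le> C * (a * norm (x - x')) powr \<beta>"
    using taylor_remainder_cube_bump_bound[OF k] by metis
  show thesis
  proof (rule that)
    \<comment> \<open>One C for the bump active at x and one for the bump active at x'.\<close>
    show "2 * C > 0" using C by simp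
    fix I :: "'j set" and a h c L :: real and b :: "'j \<Rightarrow> real^'d" and w :: "'j \<Rightarrow> real"
    assume I: "finite I" and a: "a > 0" and h: "h \<ge> 0" and w: "\<And>j. j \<in> I \<Longrightarrow> \<bar>w j\<bar> \<le> h"
      and disj: "\<And>j l x. \<lbrakk>j \<in> I; l \<in> I; \<And>i. \<bar>a * x $ i + b j $ i\<bar> \<le> 1; \<And>i. \<bar>a * x $ i + b l $ i\<bar> \<le> 1\<rbrakk> \<Longrightarrow> j = l"
      and L: "2 * C * h * a powr \<beta> \<le> L"
    define g where "g j = cube_bump (Suc (Suc (Suc k))) a (b j)" for j
    have g: "cont_diff k (g j)" for j
      using cont_diff_mono[OF cont_diff_cube_bump[of "Suc k" a "b j"], of k] by (simp add: g_def)
    have wg: "cont_diff k (\<lambda>x. w j * g j x)" for j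
      by (rule cont_diff_cmult[OF g])
    define f where "f x = c + (\<Sum>j\<in>I. w j * g j x)" for x
    have f: "cont_diff k f"
      unfolding f_def by (intro cont_diff_add cont_diff_const cont_diff_sum I wg)
    have "\<bar>taylor_remainder k f x x'\<bar> \<le> L * norm (x - x') powr \<beta>" for x x'
    proof -
      \<comment> \<open>Closed cubes complement the strict inequalities under which a remainder
        vanishes; their disjointness leaves at most one index per point.\<close>
      define near where "near y = {j \<in> I. \<forall>i. \<bar>a * y $ i + b j $ i\<bar> \<le> 1}" for y
      have finite_near: "finite (near y)" and near_1: "card (near y) \<le> 1" for y
      proof -
        show "finite (near y)" using I by (simp add: near_def)
        then show "card (near y) \<le> 1"
          using disj[of _ _ y] by (auto simp: near_def card_le_Suc0_iff_eq)
      qed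
      define \<rho> where "\<rho> = (a * norm (x - x')) powr \<beta>"
      have "taylor_remainder k f x x' = (\<Sum>j\<in>I. w j * taylor_remainder k (g j) x x')"
        unfolding f_def
        by (subst taylor_remainder_add)
          (auto simp: taylor_remainder_const taylor_remainder_sum taylor_remainder_cmult I wg g
            intro: cont_diff_const cont_diff_sum)
      also have "\<dots> = (\<Sum>j\<in>near x \<union> near x'. w j * taylor_remainder k (g j) x x')"
      proof (rule sum.mono_neutral_right)
        show "\<forall>j\<in>I - (near x \<union> near x'). w j * taylor_remainder k (g j) x x' = 0"
        proof
          fix j assume "j \<in> I - (near x \<union> near x')"
          then obtain i i' where "\<bar>a * x $ i + b j $ i\<bar> > 1" "\<bar>a * x' $ i' + b j $ i'\<bar> > 1"
            by (auto simp: near_def not_le)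
          then show "w j * taylor_remainder k (g j) x x' = 0"
            using taylor_remainder_cube_bump_eq_0[of k "Suc (Suc k)" a x i "b j" x' i'] by (simp add: g_def)
        qed
      qed (use I in \<open>auto simp: near_def\<close>)
      also have "\<bar>\<dots>\<bar> \<le> (\<Sum>j\<in>near x \<union> near x'. h * (C * \<rho>))"
      proof (rule order_trans[OF sum_abs], rule sum_mono)
        fix j assume "j \<in> near x \<union> near x'"
        then have "\<bar>w j\<bar> \<le> h" using w by (auto simp: near_def)
        then show "\<bar>w j * taylor_remainder k (g j) x x'\<bar> \<le> h * (C * \<rho>)"
          using C(2)[OF a, of "b j" x x'] unfolding abs_mult g_def \<rho>_def by (intro mult_mono) auto
      qed
      also have "\<dots> = real (card (near x \<union> near x')) * (h * (C * \<rho>))"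
        by simp
      also have "\<dots> \<le> 2 * (h * (C * \<rho>))"
      proof (rule mult_right_mono)
        show "real (card (near x \<union> near x')) \<le> 2"
          using card_Un_le[of "near x" "near x'"] near_1[of x] near_1[of x'] by linarith
      qed (use C h in \<open>auto simp: \<rho>_def\<close>)
      also have "\<dots> = (2 * C * h * a powr \<beta>) * norm (x - x') powr \<beta>"
        using a by (simp add: \<rho>_def powr_mult)
      also have "\<dots> \<le> L * norm (x - x') powr \<beta>"
        using L by (intro mult_right_mono) auto
      finally show ?thesis .
    qed
    then have "f \<in> Hoelder_class \<beta> L"
      using f by (simp add: Hoelder_class_def taylor_remainder_def k_def)
    moreover have "f = (\<lambda>x. c + (\<Sum>j\<in>I. w j * cube_bump (strict_floor \<beta> + 3) a (b j) x))"
      by (simp add: fun_eq_iff f_def g_def k_def eval_nat_numeral)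
    ultimately show "(\<lambda>x. c + (\<Sum>j\<in>I. w j * cube_bump (strict_floor \<beta> + 3) a (b j) x)) \<in> Hoelder_class \<beta> L"
      by simp
  qed
qed

section \<open>Distributions with a prescribed regression function\<close>

text \<open>The law of (X, Y) when X has law Q and, given X = x, the label is 1 with probability
  \<eta> x. Written as a density, it makes integrals two-term integrals over Q, and a change of
  \<eta> becomes a change of density.\<close>

definition joint :: "(real^'d::finite) measure \<Rightarrow> (real^'d \<Rightarrow> real) \<Rightarrow> ((real^'d) \<times> bool) measure" where
  "joint Q \<eta> = density (Q \<Otimes>\<^sub>M count_space UNIV) (\<lambda>z. ennreal (if snd z then \<eta> (fst z) else 1 - \<eta> (fst z)))"

definition is_prob_fun :: "(real^'d::finite \<Rightarrow> real) \<Rightarrow> bool" where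
  "is_prob_fun \<eta> \<longleftrightarrow> \<eta> \<in> borel_measurable borel \<and> (\<forall>x. 0 \<le> \<eta> x \<and> \<eta> x \<le> 1)"

lemma is_prob_funD [measurable_dest]: "is_prob_fun \<eta> \<Longrightarrow> \<eta> \<in> borel_measurable borel"
  by (simp add: is_prob_fun_def)

text \<open>The likelihood ratio of \<eta> + b to \<eta> when \<eta> = 1/2 wherever b is nonzero:
  (1/2 + b) / (1/2) for label 1 and (1/2 - b) / (1/2) for label 0. Where b = 0 the ratio is 1,
  whatever \<eta> is.\<close>

definition lr :: "(real^'d::finite \<Rightarrow> real) \<Rightarrow> (real^'d) \<times> bool \<Rightarrow> real" where
  "lr b z = 1 + (if snd z then 2 * b (fst z) else - 2 * b (fst z))"

locale design_measure = prob_space Q for Q :: "(real^'d::finite) measure" +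
  assumes sets_Q [simp, measurable_cong]: "sets Q = sets borel"
begin

lemma space_Q [simp]: "space Q = UNIV"
  using sets_eq_imp_space_eq[OF sets_Q] by simp

lemma finite_pair: "finite_measure (Q \<Otimes>\<^sub>M count_space (UNIV :: bool set))"
  by (intro finite_measure_pair_measure finite_measure_count_space) (auto intro: finite_measure_axioms)

lemma pair_sigma: "pair_sigma_finite Q (count_space (UNIV :: bool set))"
  by (intro pair_sigma_finite.intro sigma_finite_measure_axioms sigma_finite_measure_count_space)

lemma sets_joint [simp, measurable_cong]: "sets (joint Q \<eta>) = sets (borel \<Otimes>\<^sub>M count_space UNIV)"
  unfolding joint_def sets_density by (intro sets_pair_measure_cong) auto

lemma space_joint [simp]: "space (joint Q \<eta>) = UNIV"
  using sets_eq_imp_space_eq[OF sets_joint, of \<eta>] by (simp add: space_pair_measure)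

lemma measurable_pair_Q:
  "f \<in> measurable (Q \<Otimes>\<^sub>M count_space UNIV) N \<longleftrightarrow> f \<in> measurable (borel \<Otimes>\<^sub>M count_space UNIV) N"
  by (subst measurable_cong_sets[OF sets_pair_measure_cong[OF sets_Q refl] refl]) simp

lemma label_weight_measurable:
  assumes "is_prob_fun \<eta>"
  shows "(\<lambda>z. if snd z then \<eta> (fst z) else 1 - \<eta> (fst z)) \<in> borel_measurable (Q \<Otimes>\<^sub>M count_space UNIV)"
proof -
  have [measurable]: "\<eta> \<in> borel_measurable borel" using assms by (rule is_prob_funD)
  have [measurable]: "Measurable.pred (Q \<Otimes>\<^sub>M count_space UNIV) snd" by (rule measurable_snd)
  show ?thesis by measurable
qed

lemma nn_integral_joint:
  assumes [measurable]: "is_prob_fun \<eta>" "f \<in> borel_measurable (borel \<Otimes>\<^sub>M count_space UNIV)"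
  shows "(\<integral>\<^sup>+z. f z \<partial>joint Q \<eta>) = (\<integral>\<^sup>+x. ennreal (\<eta> x) * f (x, True) + ennreal (1 - \<eta> x) * f (x, False) \<partial>Q)"
proof -
  interpret pair_sigma_finite Q "count_space (UNIV :: bool set)" by (rule pair_sigma)
  have "(\<integral>\<^sup>+z. f z \<partial>joint Q \<eta>) =
      (\<integral>\<^sup>+z. ennreal (if snd z then \<eta> (fst z) else 1 - \<eta> (fst z)) * f z \<partial>(Q \<Otimes>\<^sub>M count_space UNIV))"
    unfolding joint_def using label_weight_measurable[OF assms(1)]
    by (subst nn_integral_density) auto
  also have "\<dots> = (\<integral>\<^sup>+x. (\<integral>\<^sup>+y. ennreal (if y then \<eta> x else 1 - \<eta> x) * f (x, y) \<partial>count_space UNIV) \<partial>Q)"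
    using label_weight_measurable[OF assms(1)] assms(2)
    by (subst M2.nn_integral_fst[symmetric], unfold fst_conv snd_conv)
      (auto simp: measurable_pair_Q intro!: borel_measurable_times_ennreal measurable_compose[OF _ measurable_ennreal])
  also have "\<dots> = (\<integral>\<^sup>+x. ennreal (\<eta> x) * f (x, True) + ennreal (1 - \<eta> x) * f (x, False) \<partial>Q)"
    by (simp add: nn_integral_count_space_finite UNIV_bool add.commute)
  finally show ?thesis .
qed

lemma integral_joint:
  assumes \<eta> [measurable]: "is_prob_fun \<eta>"
    and f [measurable]: "f \<in> borel_measurable (borel \<Otimes>\<^sub>M count_space UNIV)"
    and B: "\<And>z. \<bar>f z\<bar> \<le> B"
  shows "(\<integral>z. f z \<partial>joint Q \<eta>) = (\<integral>x. \<eta> x * f (x, True) + (1 - \<eta> x) * f (x, False) \<partial>Q)"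
proof -
  interpret pair_sigma_finite Q "count_space (UNIV :: bool set)" by (rule pair_sigma)
  have \<eta>': "0 \<le> \<eta> x" "\<eta> x \<le> 1" for x using \<eta> by (auto simp: is_prob_fun_def)
  have "(\<integral>z. f z \<partial>joint Q \<eta>) =
      (\<integral>z. (if snd z then \<eta> (fst z) else 1 - \<eta> (fst z)) * f z \<partial>(Q \<Otimes>\<^sub>M count_space UNIV))"
    unfolding joint_def using \<eta>' label_weight_measurable[OF \<eta>]
    by (subst integral_density) auto
  also have "\<dots> = (\<integral>x. (\<integral>y. (if y then \<eta> x else 1 - \<eta> x) * f (x, y) \<partial>count_space UNIV) \<partial>Q)"
  proof (subst integral_fst'[symmetric])
    show "integrable (Q \<Otimes>\<^sub>M count_space UNIV) (\<lambda>z. (if snd z then \<eta> (fst z) else 1 - \<eta> (fst z)) * f z)"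
    proof (rule finite_measure.integrable_const_bound[OF finite_pair, where B = "B"])
      show "AE z in Q \<Otimes>\<^sub>M count_space UNIV. norm ((if snd z then \<eta> (fst z) else 1 - \<eta> (fst z)) * f z) \<le> B"
      proof (rule AE_I2)
        fix z
        have "\<bar>if snd z then \<eta> (fst z) else 1 - \<eta> (fst z)\<bar> * \<bar>f z\<bar> \<le> 1 * B"
          using \<eta>' B by (intro mult_mono) auto
        then show "norm ((if snd z then \<eta> (fst z) else 1 - \<eta> (fst z)) * f z) \<le> B"
          by (simp add: abs_mult)
      qed
    qed (use label_weight_measurable[OF \<eta>] f in \<open>auto simp: measurable_pair_Q intro!: borel_measurable_times\<close>)
  qed (simp only: fst_conv snd_conv)
  also have "\<dots> = (\<integral>x. \<eta> x * f (x, True) + (1 - \<eta> x) * f (x, False) \<partial>Q)"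
    by (simp add: lebesgue_integral_count_space_finite UNIV_bool add.commute)
  finally show ?thesis .
qed

lemma prob_space_joint:
  assumes "is_prob_fun \<eta>"
  shows "prob_space (joint Q \<eta>)"
proof
  have "emeasure (joint Q \<eta>) (space (joint Q \<eta>)) = (\<integral>\<^sup>+z. 1 \<partial>joint Q \<eta>)"
    by simp
  also have "\<dots> = (\<integral>\<^sup>+x. 1 \<partial>Q)"
    using assms by (subst nn_integral_joint) (auto simp: is_prob_fun_def ennreal_plus[symmetric] simp del: ennreal_plus)
  finally show "emeasure (joint Q \<eta>) (space (joint Q \<eta>)) = 1"
    by (simp add: emeasure_space_1[unfolded space_Q])
qed

lemma marginal_joint:
  assumes "is_prob_fun \<eta>"
  shows "marginal (joint Q \<eta>) = Q"
proof (rule measure_eqI)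
  fix A assume "A \<in> sets (marginal (joint Q \<eta>))"
  then have A [measurable]: "A \<in> sets borel" by (simp add: marginal_def)
  have "emeasure (marginal (joint Q \<eta>)) A = (\<integral>\<^sup>+z. indicator A (fst z) \<partial>joint Q \<eta>)"
  proof -
    have "emeasure (marginal (joint Q \<eta>)) A = (\<integral>\<^sup>+x. indicator A x \<partial>marginal (joint Q \<eta>))"
      by (rule nn_integral_indicator[symmetric]) (simp add: marginal_def)
    also have "\<dots> = (\<integral>\<^sup>+z. indicator A (fst z) \<partial>joint Q \<eta>)"
      unfolding marginal_def by (rule nn_integral_distr) auto
    finally show ?thesis .
  qed
  also have "\<dots> = (\<integral>\<^sup>+x. indicator A x \<partial>Q)"
    using assms
    by (subst nn_integral_joint)
      (auto simp: is_prob_fun_def ennreal_plus[symmetric] distrib_right[symmetric] simp del: ennreal_plus intro!: nn_integral_cong)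
  finally show "emeasure (marginal (joint Q \<eta>)) A = emeasure Q A"
    by simp
qed (simp add: marginal_def)

text \<open>A set in the sigma-algebra generated by X is the preimage of a Borel set B under
  \<open>fst\<close>; tested against it, both the label and \<eta>(X) integrate to the integral of
  \<eta> over B.\<close>

lemma is_regression_joint:
  assumes \<eta> [measurable]: "is_prob_fun \<eta>"
  shows "is_regression (joint Q \<eta>) \<eta>"
proof -
  let ?J = "joint Q \<eta>"
  let ?F = "vimage_algebra (space ?J) fst (borel :: (real^'d) measure)"
  have \<eta>': "0 \<le> \<eta> x" "\<eta> x \<le> 1" for x using \<eta> by (auto simp: is_prob_fun_def)
  interpret J: prob_space ?J by (rule prob_space_joint) (rule \<eta>)
  have fstF: "fst \<in> ?F \<rightarrow>\<^sub>M borel"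
    by (rule measurable_vimage_algebra1) simp
  have sub: "subalgebra ?J ?F"
    unfolding subalgebra_def
  proof
    show "sets ?F \<subseteq> sets ?J"
      by (rule sets_image_in_sets) auto
  qed simp
  interpret sigma_finite_subalgebra ?J ?F
    by (intro finite_measure_subalgebra_is_sigma_finite finite_measure_subalgebra.intro
        finite_measure_subalgebra_axioms.intro sub J.finite_measure_axioms)
  have [measurable]: "(\<lambda>z. \<eta> (fst z)) \<in> borel_measurable ?J"
    using measurable_compose[OF measurable_fst is_prob_funD[OF \<eta>]] by (simp cong: measurable_cong_sets)
  have "AE z in ?J. real_cond_exp ?J ?F (indicat_real {z. snd z}) z = \<eta> (fst z)"
  proof (rule real_cond_exp_charact)
    fix A assume "A \<in> sets ?F"
    then obtain B where B [measurable]: "B \<in> sets borel" and A: "A = fst -` B"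
      by (auto simp: sets_vimage_algebra2)
    have "(\<integral>z\<in>A. indicat_real {z. snd z} z \<partial>?J) = (\<integral>z. indicator B (fst z) * indicat_real {z. snd z} z \<partial>?J)"
      unfolding set_lebesgue_integral_def by (intro Bochner_Integration.integral_cong) (auto simp: A indicator_def)
    also have "\<dots> = (\<integral>x. \<eta> x * indicator B x \<partial>Q)"
      by (subst integral_joint[where B = 1]) (auto simp: \<eta> indicator_def)
    also have "\<dots> = (\<integral>z. indicator B (fst z) * \<eta> (fst z) \<partial>?J)"
      by (subst integral_joint[where B = 1]) (auto simp: \<eta> \<eta>' indicator_def algebra_simps intro!: Bochner_Integration.integral_cong)
    also have "\<dots> = (\<integral>z\<in>A. \<eta> (fst z) \<partial>?J)"
      unfolding set_lebesgue_integral_def by (intro Bochner_Integration.integral_cong) (auto simp: A indicator_def)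
    finally show "(\<integral>z\<in>A. indicat_real {z. snd z} z \<partial>?J) = (\<integral>z\<in>A. \<eta> (fst z) \<partial>?J)" .
  next
    show "integrable ?J (indicat_real {z. snd z})"
      by (rule J.integrable_const_bound[where B = 1]) auto
    show "integrable ?J (\<lambda>z. \<eta> (fst z))"
      by (rule J.integrable_const_bound[where B = 1]) (auto simp: \<eta>')
    show "(\<lambda>z. \<eta> (fst z)) \<in> borel_measurable ?F"
      using measurable_compose[OF fstF is_prob_funD[OF \<eta>]] .
  qed
  then have "AE z in ?J. \<eta> (fst z) = real_cond_exp ?J ?F (indicat_real {z. snd z}) z"
    by eventually_elim simp
  then show ?thesis
    using \<eta> by (auto simp: is_regression_def is_prob_fun_def)
qed

text \<open>The choice in \<open>regression\<close> may pick a version other than \<eta>. Both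
  represent the same conditional expectation, so they agree almost everywhere, which is enough for
  the margin condition and the Bayes risk.\<close>

lemma regression_joint:
  assumes \<eta> [measurable]: "is_prob_fun \<eta>"
  shows "is_prob_fun (regression (joint Q \<eta>))" "AE x in Q. regression (joint Q \<eta>) x = \<eta> x"
proof -
  have reg: "is_regression (joint Q \<eta>) (regression (joint Q \<eta>))"
    unfolding regression_def by (rule someI[of _ \<eta>]) (rule is_regression_joint[OF \<eta>])
  then show r [measurable]: "is_prob_fun (regression (joint Q \<eta>))"
    by (simp add: is_regression_def is_prob_fun_def)
  have "AE z in joint Q \<eta>. regression (joint Q \<eta>) (fst z) = \<eta> (fst z)"
    using reg is_regression_joint[OF \<eta>] unfolding is_regression_def by (auto elim: eventually_elim2)
  then have "AE x in marginal (joint Q \<eta>). regression (joint Q \<eta>) x = \<eta> x"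
    unfolding marginal_def by (subst AE_distr_iff) auto
  then show "AE x in Q. regression (joint Q \<eta>) x = \<eta> x"
    unfolding marginal_joint[OF \<eta>] .
qed

lemma margin_measure_joint:
  assumes \<eta> [measurable]: "is_prob_fun \<eta>"
  shows "measure (marginal (joint Q \<eta>))
      {x. 0 < \<bar>regression (joint Q \<eta>) x - 1/2\<bar> \<and> \<bar>regression (joint Q \<eta>) x - 1/2\<bar> \<le> t} =
    measure Q {x. 0 < \<bar>\<eta> x - 1/2\<bar> \<and> \<bar>\<eta> x - 1/2\<bar> \<le> t}"
proof -
  note r [measurable] = regression_joint(1)[OF \<eta>]
  show ?thesis
    unfolding marginal_joint[OF \<eta>]
  proof (rule measure_eq_AE)
    show "AE x in Q. (x \<in> {x. 0 < \<bar>regression (joint Q \<eta>) x - 1/2\<bar> \<and> \<bar>regression (joint Q \<eta>) x - 1/2\<bar> \<le> t}) =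
       (x \<in> {x. 0 < \<bar>\<eta> x - 1/2\<bar> \<and> \<bar>\<eta> x - 1/2\<bar> \<le> t})"
      using regression_joint(2)[OF \<eta>] by eventually_elim simp
  qed measurable
qed

lemma risk_joint:
  assumes \<eta> [measurable]: "is_prob_fun \<eta>" and g [measurable]: "Measurable.pred borel g"
  shows "risk (joint Q \<eta>) g = (\<integral>x. (if g x then 1 - \<eta> x else \<eta> x) \<partial>Q)"
proof -
  have "risk (joint Q \<eta>) g = (\<integral>z. indicator {z. snd z \<noteq> g (fst z)} z \<partial>joint Q \<eta>)"
    by (simp add: risk_def)
  also have "\<dots> = (\<integral>x. (if g x then 1 - \<eta> x else \<eta> x) \<partial>Q)"
    by (subst integral_joint[where B = 1]) (auto simp: \<eta> indicator_def intro!: Bochner_Integration.integral_cong)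
  finally show ?thesis .
qed

text \<open>At each x a decision against the Bayes rule costs |2 * \<eta> x - 1| more than the Bayes
  decision.\<close>

lemma excess_risk_joint:
  assumes \<eta> [measurable]: "is_prob_fun \<eta>" and g [measurable]: "Measurable.pred borel g"
  shows "risk (joint Q \<eta>) g - risk (joint Q \<eta>) (bayes_rule (joint Q \<eta>)) =
    (\<integral>x. (if g x \<longleftrightarrow> \<eta> x \<ge> 1/2 then 0 else \<bar>2 * \<eta> x - 1\<bar>) \<partial>Q)"
proof -
  have \<eta>': "0 \<le> \<eta> x" "\<eta> x \<le> 1" for x using \<eta> by (auto simp: is_prob_fun_def)
  note r [measurable] = regression_joint(1)[OF \<eta>]
  have b: "Measurable.pred borel (bayes_rule (joint Q \<eta>))"
    unfolding bayes_rule_def by measurable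
  have "risk (joint Q \<eta>) (bayes_rule (joint Q \<eta>)) = (\<integral>x. (if \<eta> x \<ge> 1/2 then 1 - \<eta> x else \<eta> x) \<partial>Q)"
    unfolding risk_joint[OF \<eta> b]
  proof (rule integral_cong_AE)
    show "AE x in Q. (if bayes_rule (joint Q \<eta>) x then 1 - \<eta> x else \<eta> x) = (if \<eta> x \<ge> 1/2 then 1 - \<eta> x else \<eta> x)"
      using regression_joint(2)[OF \<eta>] by eventually_elim (simp add: bayes_rule_def)
  qed (use b in measurable)
  then have "risk (joint Q \<eta>) g - risk (joint Q \<eta>) (bayes_rule (joint Q \<eta>)) =
     (\<integral>x. (if g x then 1 - \<eta> x else \<eta> x) - (if \<eta> x \<ge> 1/2 then 1 - \<eta> x else \<eta> x) \<partial>Q)"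
    unfolding risk_joint[OF \<eta> g]
    by (simp, subst Bochner_Integration.integral_diff)
      (auto intro!: integrable_const_bound[where B = 1] simp: \<eta>')
  also have "\<dots> = (\<integral>x. (if g x \<longleftrightarrow> \<eta> x \<ge> 1/2 then 0 else \<bar>2 * \<eta> x - 1\<bar>) \<partial>Q)"
    by (intro Bochner_Integration.integral_cong) auto
  finally show ?thesis .
qed

lemma joint_perturb:
  assumes \<eta> [measurable]: "is_prob_fun \<eta>" and b [measurable]: "b \<in> borel_measurable borel"
    and half: "\<And>x. \<bar>b x\<bar> \<le> 1/2" "\<And>x. b x \<noteq> 0 \<Longrightarrow> \<eta> x = 1/2"
  shows "joint Q (\<lambda>x. \<eta> x + b x) = density (joint Q \<eta>) (\<lambda>z. ennreal (lr b z))"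
proof -
  have \<eta>': "0 \<le> \<eta> x" "\<eta> x \<le> 1" for x using \<eta> by (auto simp: is_prob_fun_def)
  have pos: "0 \<le> lr b z" for z
    using half(1)[of "fst z"] by (auto simp: lr_def abs_le_iff)
  have [measurable]: "lr b \<in> borel_measurable (borel \<Otimes>\<^sub>M count_space UNIV)"
    unfolding lr_def by measurable
  have "(if snd z then \<eta> (fst z) + b (fst z) else 1 - (\<eta> (fst z) + b (fst z))) =
      (if snd z then \<eta> (fst z) else 1 - \<eta> (fst z)) * lr b z" for z
    using half(2)[of "fst z"] by (cases "b (fst z) = 0") (auto simp: lr_def field_simps)
  then show ?thesis
    unfolding joint_def using \<eta>' pos label_weight_measurable[OF \<eta>]
    by (subst density_density_eq) (auto intro!: density_cong simp: ennreal_mult)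
qed

end

text \<open>For independent observations densities multiply; it suffices to compare the two measures
  on measurable rectangles.\<close>

lemma PiM_density:
  fixes \<rho> :: "'b \<Rightarrow> real"
  assumes "prob_space P" "prob_space (density P (\<lambda>z. ennreal (\<rho> z)))" "finite I"
    and [measurable]: "\<rho> \<in> borel_measurable P" and \<rho>: "\<And>z. 0 \<le> \<rho> z"
  shows "PiM I (\<lambda>_. density P (\<lambda>z. ennreal (\<rho> z))) =
    density (PiM I (\<lambda>_. P)) (\<lambda>z. ennreal (\<Prod>i\<in>I. \<rho> (z i)))"
proof -
  let ?D = "density P (\<lambda>z. ennreal (\<rho> z))"
  interpret P: prob_space P by fact
  interpret D: prob_space ?D by fact
  interpret PP: product_prob_space "\<lambda>_. P" I by unfold_locales
  interpret DD: product_prob_space "\<lambda>_. ?D" I by unfold_locales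
  have "density (PiM I (\<lambda>_. P)) (\<lambda>z. ennreal (\<Prod>i\<in>I. \<rho> (z i))) = PiM I (\<lambda>_. ?D)"
  proof (rule DD.PiM_eqI)
    show "finite I" by fact
    show "sets (density (PiM I (\<lambda>_. P)) (\<lambda>z. ennreal (\<Prod>i\<in>I. \<rho> (z i)))) = sets (PiM I (\<lambda>_. ?D))"
      by (simp cong: sets_PiM_cong)
    fix A assume "\<And>i. i \<in> I \<Longrightarrow> A i \<in> sets ?D"
    then have A [measurable]: "\<And>i. i \<in> I \<Longrightarrow> A i \<in> sets P" by simp
    have "emeasure (density (PiM I (\<lambda>_. P)) (\<lambda>z. ennreal (\<Prod>i\<in>I. \<rho> (z i)))) (PiE I A) =
      (\<integral>\<^sup>+z. ennreal (\<Prod>i\<in>I. \<rho> (z i)) * indicator (PiE I A) z \<partial>PiM I (\<lambda>_. P))"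
      using \<open>finite I\<close> by (subst emeasure_density) auto
    also have "\<dots> = (\<integral>\<^sup>+z. (\<Prod>i\<in>I. ennreal (\<rho> (z i)) * indicator (A i) (z i)) \<partial>PiM I (\<lambda>_. P))"
    proof (rule nn_integral_cong)
      fix z assume z: "z \<in> space (PiM I (\<lambda>_. P))"
      have "indicator (PiE I A) z = (\<Prod>i\<in>I. indicator (A i) (z i) :: ennreal)"
      proof (cases "z \<in> PiE I A")
        case True then show ?thesis by (auto simp: PiE_iff)
      next
        case False
        then obtain i where "i \<in> I" "z i \<notin> A i" using z by (auto simp: space_PiM PiE_iff)
        then have "(\<Prod>i\<in>I. indicator (A i) (z i) :: ennreal) = 0"
          using \<open>finite I\<close> by (intro prod_zero bexI[of _ i]) auto
        then show ?thesis using False by simp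
      qed
      then show "ennreal (\<Prod>i\<in>I. \<rho> (z i)) * indicator (PiE I A) z = (\<Prod>i\<in>I. ennreal (\<rho> (z i)) * indicator (A i) (z i))"
        using \<rho> by (simp add: prod.distrib prod_ennreal)
    qed
    also have "\<dots> = (\<Prod>i\<in>I. \<integral>\<^sup>+z. ennreal (\<rho> z) * indicator (A i) z \<partial>P)"
      using \<open>finite I\<close> by (subst PP.product_nn_integral_prod) auto
    also have "\<dots> = (\<Prod>i\<in>I. emeasure ?D (A i))"
      by (intro prod.cong refl) (simp add: emeasure_density)
    finally show "emeasure (density (PiM I (\<lambda>_. P)) (\<lambda>z. ennreal (\<Prod>i\<in>I. \<rho> (z i)))) (PiE I A) =
      (\<Prod>i\<in>I. emeasure ?D (A i))" .
  qed
  then show ?thesis by simp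
qed

section \<open>Assouad's lemma\<close>

text \<open>Split W into a and W - a and use p - 3/4 + (p - 1)^2 = (p - 1/2)^2, and the same for q.
  For likelihood ratios p and q the squares integrate to chi-square distances, so the sum of two
  errors is bounded below without passing through total variation.\<close>

lemma two_point_pointwise:
  fixes a W p q :: real
  assumes "0 \<le> a" "a \<le> W"
  shows "W * (3/4 - ((p\<^sup>2 - 2 * p + 1) + (q\<^sup>2 - 2 * q + 1))) \<le> p * a + q * (W - a)"
proof -
  have "p * a + q * (W - a) - W * (3/4 - ((p\<^sup>2 - 2 * p + 1) + (q\<^sup>2 - 2 * q + 1))) =
      a * (p - 1/2)\<^sup>2 + (W - a) * (q - 1/2)\<^sup>2 + (W - a) * (p - 1)\<^sup>2 + a * (q - 1)\<^sup>2"
    by (simp add: power2_eq_square field_simps)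
  also have "\<dots> \<ge> 0"
    using assms by (intro add_nonneg_nonneg mult_nonneg_nonneg) auto
  finally show ?thesis by simp
qed

text \<open>A sign pattern is coded by the set S of the indices with a plus sign.\<close>

definition mixture :: "nat \<Rightarrow> (nat \<Rightarrow> real^'d::finite \<Rightarrow> real) \<Rightarrow> nat set \<Rightarrow> real^'d \<Rightarrow> real" where
  "mixture m b S x = 1/2 + (\<Sum>j<m. if j \<in> S then b j x else - b j x)"

text \<open>Disjoint supports collapse the sum to at most one term, so pointwise claims about
  \<open>mixture\<close> split into these two cases.\<close>

lemma mixture_cases:
  assumes disj: "\<And>i j x. i < m \<Longrightarrow> j < m \<Longrightarrow> b i x \<noteq> 0 \<Longrightarrow> b j x \<noteq> 0 \<Longrightarrow> i = j"
  obtains "\<And>j. j < m \<Longrightarrow> b j x = 0" "mixture m b S x = 1/2"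
  | j where "j < m" "b j x \<noteq> 0" "\<And>i. i < m \<Longrightarrow> i \<noteq> j \<Longrightarrow> b i x = 0"
      "mixture m b S x = 1/2 + (if j \<in> S then b j x else - b j x)"
proof (cases "\<exists>j<m. b j x \<noteq> 0")
  case False
  then show thesis by (intro that(1)) (auto simp: mixture_def intro!: sum.neutral)
next
  case True
  then obtain j where j: "j < m" "b j x \<noteq> 0" by blast
  then have z: "b i x = 0" if "i < m" "i \<noteq> j" for i using disj that by blast
  have "(\<Sum>i<m. if i \<in> S then b i x else - b i x) = (\<Sum>i\<in>{j}. if i \<in> S then b i x else - b i x)"
    by (rule sum.mono_neutral_right) (use j z in auto)
  then show thesis by (intro that(2)[of j]) (use j z in \<open>auto simp: mixture_def\<close>)
qed

lemma is_prob_fun_mixture: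
  assumes b: "\<And>j. j < m \<Longrightarrow> b j \<in> borel_measurable borel" "\<And>j x. j < m \<Longrightarrow> 0 \<le> b j x \<and> b j x \<le> 1/2"
    and disj: "\<And>i j x. i < m \<Longrightarrow> j < m \<Longrightarrow> b i x \<noteq> 0 \<Longrightarrow> b j x \<noteq> 0 \<Longrightarrow> i = j"
  shows "is_prob_fun (mixture m b S)"
  unfolding is_prob_fun_def
proof (intro conjI allI)
  show "mixture m b S \<in> borel_measurable borel"
    unfolding mixture_def using b(1)
    by (intro borel_measurable_add borel_measurable_sum) (auto intro: borel_measurable_uminus)
  fix x
  have "0 \<le> mixture m b S x \<and> mixture m b S x \<le> 1"
  proof (rule mixture_cases[where m = m and b = b and S = S and x = x, OF disj])
    fix j assume "j < m" "mixture m b S x = 1/2 + (if j \<in> S then b j x else - b j x)"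
    then show ?thesis using b(2)[of j x] by auto
  qed auto
  then show "0 \<le> mixture m b S x" "mixture m b S x \<le> 1" by auto
qed

section \<open>Likelihood ratios and the comparison of two hypotheses\<close>

context design_measure
begin

lemma sets_joint_Z: "sets (joint Q \<eta>) = sets Z_space"
  by (simp add: Z_space_def)

lemma sets_sample: "sets (PiM I (\<lambda>_. joint Q \<eta>)) = sets (PiM I (\<lambda>_. Z_space))"
  by (intro sets_PiM_cong refl sets_joint_Z)

lemma prob_space_sample: "is_prob_fun \<eta> \<Longrightarrow> prob_space (PiM I (\<lambda>_. joint Q \<eta>))"
  by (intro prob_space_PiM prob_space_joint)

lemma lr_measurable:
  assumes "b \<in> borel_measurable borel"
  shows "lr b \<in> borel_measurable (joint Q \<eta>)"
proof -
  have [measurable]: "Measurable.pred (joint Q \<eta>) snd" "(\<lambda>z. b (fst z)) \<in> borel_measurable (joint Q \<eta>)"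
    using assms measurable_compose[OF measurable_fst assms]
    by (auto simp: measurable_cong_sets[OF sets_joint refl])
  show ?thesis unfolding lr_def by measurable
qed

lemma lr_bounds: "\<bar>b (fst z)\<bar> \<le> 1/2 \<Longrightarrow> 0 \<le> lr b z \<and> lr b z \<le> 2"
  by (auto simp: lr_def abs_le_iff)

text \<open>Over a fair coin the ratios 1 + 2b and 1 - 2b average to 1 and their squares to 1 + 4
  b^2; independence turns these moments into n-th powers. The function a will be the loss of a
  classifier, bounded by W.\<close>

lemma likelihood_ratio:
  assumes \<eta>: "is_prob_fun \<eta>" and b: "b \<in> borel_measurable borel"
    and half: "\<And>x. \<bar>b x\<bar> \<le> 1/2" "\<And>x. b x \<noteq> 0 \<Longrightarrow> \<eta> x = 1/2"
    and a: "a \<in> borel_measurable (PiM {..<n} (\<lambda>_. Z_space))" "\<And>z. 0 \<le> a z \<and> a z \<le> W"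
  defines "p \<equiv> \<lambda>z. \<Prod>i<n. lr b (z i)"
  defines "N \<equiv> PiM {..<n} (\<lambda>_. joint Q \<eta>)"
  shows "(\<integral>z. a z \<partial>PiM {..<n} (\<lambda>_. joint Q (\<lambda>x. \<eta> x + b x))) = (\<integral>z. p z * a z \<partial>N)"
    and "integrable N (\<lambda>z. p z * a z)" and "integrable N p" and "integrable N (\<lambda>z. (p z)\<^sup>2)"
    and "(\<integral>z. p z \<partial>N) = 1" and "(\<integral>z. (p z)\<^sup>2 \<partial>N) = (1 + 4 * (\<integral>x. (b x)\<^sup>2 \<partial>Q)) ^ n"
proof -
  have \<eta>': "0 \<le> \<eta> x" "\<eta> x \<le> 1" for x using \<eta> by (auto simp: is_prob_fun_def)
  note lrm [measurable] = lr_measurable[OF b]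
  note lrb = lr_bounds[of b, OF half(1)]
  interpret J: prob_space "joint Q \<eta>" by (rule prob_space_joint[OF \<eta>])
  interpret N: prob_space N unfolding N_def by (rule prob_space_sample[OF \<eta>])
  interpret PJ: product_prob_space "\<lambda>_. joint Q \<eta>" "{..<n}" by unfold_locales
  have am [measurable]: "a \<in> borel_measurable N"
    using a(1) by (simp add: N_def measurable_cong_sets[OF sets_sample refl])
  have pm [measurable]: "p \<in> borel_measurable N"
    unfolding p_def N_def by measurable
  \<comment> \<open>The upper bound 2^n only serves integrability.\<close>
  have p_bounds: "0 \<le> p z" "p z \<le> 2 ^ n" for z
  proof -
    show "0 \<le> p z" unfolding p_def by (rule prod_nonneg) (use lrb in blast)
    show "p z \<le> 2 ^ n"
      using lrb prod_mono[of "{..<n}" "\<lambda>i. lr b (z i)" "\<lambda>_. 2"] by (auto simp: p_def)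
  qed
  have prob_pert: "is_prob_fun (\<lambda>x. \<eta> x + b x)"
    unfolding is_prob_fun_def
  proof (intro conjI allI)
    show "(\<lambda>x. \<eta> x + b x) \<in> borel_measurable borel"
      using is_prob_funD[OF \<eta>] b by measurable
    fix x
    show "0 \<le> \<eta> x + b x" "\<eta> x + b x \<le> 1"
      using \<eta>'[of x] half(1)[of x] half(2)[of x] by (cases "b x = 0"; force simp: abs_le_iff)+
  qed
  have E: "joint Q (\<lambda>x. \<eta> x + b x) = density (joint Q \<eta>) (\<lambda>z. ennreal (lr b z))"
    by (rule joint_perturb) (use \<eta> b half in auto)
  have "PiM {..<n} (\<lambda>_. density (joint Q \<eta>) (\<lambda>z. ennreal (lr b z))) = density N (\<lambda>z. ennreal (p z))"
    unfolding N_def p_def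
  proof (rule PiM_density)
    show "prob_space (density (joint Q \<eta>) (\<lambda>z. ennreal (lr b z)))"
      using prob_space_joint[OF prob_pert] unfolding E .
  qed (use lrm lrb J.prob_space_axioms in auto)
  then have D: "PiM {..<n} (\<lambda>_. joint Q (\<lambda>x. \<eta> x + b x)) = density N (\<lambda>z. ennreal (p z))"
    using E by presburger
  show "(\<integral>z. a z \<partial>PiM {..<n} (\<lambda>_. joint Q (\<lambda>x. \<eta> x + b x))) = (\<integral>z. p z * a z \<partial>N)"
    unfolding D by (subst integral_density) (use p_bounds in auto)
  show "integrable N p"
    by (rule N.integrable_const_bound[where B = "2 ^ n"]) (use p_bounds in auto)
  show "integrable N (\<lambda>z. (p z)\<^sup>2)"
    by (rule N.integrable_const_bound[where B = "(2 ^ n)\<^sup>2"]) (use p_bounds in \<open>auto intro!: power_mono\<close>)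
  have "W \<ge> 0" using a(2)[of undefined] by linarith
  then show "integrable N (\<lambda>z. p z * a z)"
    by (intro N.integrable_const_bound[where B = "2 ^ n * W"])
      (use p_bounds a in \<open>auto simp: abs_mult intro!: mult_mono\<close>)
  have lr_int: "integrable (joint Q \<eta>) (lr b)" "integrable (joint Q \<eta>) (\<lambda>z. (lr b z)\<^sup>2)"
  proof -
    show "integrable (joint Q \<eta>) (lr b)"
      by (rule J.integrable_const_bound[where B = 2]) (use lrb in auto)
    have "norm ((lr b z)\<^sup>2) \<le> 2\<^sup>2" for z
      using lrb[of z] by (simp only: real_norm_def abs_power2 power_mono)
    then show "integrable (joint Q \<eta>) (\<lambda>z. (lr b z)\<^sup>2)"
      by (intro J.integrable_const_bound[where B = "2\<^sup>2"]) auto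
  qed
  have lrm': "lr b \<in> borel_measurable (borel \<Otimes>\<^sub>M count_space UNIV)"
    using lrm by (simp add: measurable_cong_sets[OF sets_joint refl])
  have "(\<integral>z. lr b z \<partial>joint Q \<eta>) = (\<integral>x. 1 \<partial>Q)"
  proof (subst integral_joint[where B = 2, OF \<eta> lrm'])
    show "\<bar>lr b z\<bar> \<le> 2" for z using lrb[of z] by simp
    have "\<eta> x * lr b (x, True) + (1 - \<eta> x) * lr b (x, False) = 1" for x
      using half(2)[of x] by (cases "b x = 0") (auto simp: lr_def field_simps)
    then show "(\<integral>x. \<eta> x * lr b (x, True) + (1 - \<eta> x) * lr b (x, False) \<partial>Q) = (\<integral>x. 1 \<partial>Q)"
      by simp
  qed
  then show "(\<integral>z. p z \<partial>N) = 1"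
    unfolding p_def N_def by (subst PJ.product_integral_prod) (use lr_int prob_space in auto)
  have "(\<integral>z. (lr b z)\<^sup>2 \<partial>joint Q \<eta>) = (\<integral>x. 1 + 4 * (b x)\<^sup>2 \<partial>Q)"
  proof (subst integral_joint[where B = "2\<^sup>2", OF \<eta>])
    show "(\<lambda>z. (lr b z)\<^sup>2) \<in> borel_measurable (borel \<Otimes>\<^sub>M count_space UNIV)"
      using lrm' by measurable
    show "\<bar>(lr b z)\<^sup>2\<bar> \<le> 2\<^sup>2" for z
      using lrb[of z] by (simp only: abs_power2 power_mono)
    have "\<eta> x * (lr b (x, True))\<^sup>2 + (1 - \<eta> x) * (lr b (x, False))\<^sup>2 = 1 + 4 * (b x)\<^sup>2" for x
      using half(2)[of x] by (cases "b x = 0") (auto simp: lr_def power2_eq_square field_simps)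
    then show "(\<integral>x. \<eta> x * (lr b (x, True))\<^sup>2 + (1 - \<eta> x) * (lr b (x, False))\<^sup>2 \<partial>Q) = (\<integral>x. 1 + 4 * (b x)\<^sup>2 \<partial>Q)"
      by simp
  qed
  also have "\<dots> = 1 + 4 * (\<integral>x. (b x)\<^sup>2 \<partial>Q)"
  proof (subst Bochner_Integration.integral_add)
    have "integrable Q (\<lambda>x. (b x)\<^sup>2)"
    proof (rule integrable_const_bound[where B = "(1/2)\<^sup>2"])
      show "AE x in Q. norm ((b x)\<^sup>2) \<le> (1/2)\<^sup>2"
        using half(1) power_mono[of "\<bar>b _\<bar>" "1/2" 2] by (auto simp: power2_abs)
    qed (use b in measurable)
    then show "integrable Q (\<lambda>x. 4 * (b x)\<^sup>2)" by simp
  qed (auto simp: prob_space[unfolded space_Q])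
  finally show "(\<integral>z. (p z)\<^sup>2 \<partial>N) = (1 + 4 * (\<integral>x. (b x)\<^sup>2 \<partial>Q)) ^ n"
    unfolding p_def N_def prod_power_distrib
    by (subst PJ.product_integral_prod) (use lr_int in auto)
qed

text \<open>The two hypotheses are compared through the chi-square distance to the common midpoint
  \<open>joint Q \<eta>\<close>, which factorises over the sample.\<close>

lemma two_point_bound:
  assumes \<eta>: "is_prob_fun \<eta>" and b: "b \<in> borel_measurable borel"
    and half: "\<And>x. \<bar>b x\<bar> \<le> 1/2" "\<And>x. b x \<noteq> 0 \<Longrightarrow> \<eta> x = 1/2"
    and a: "a \<in> borel_measurable (PiM {..<n} (\<lambda>_. Z_space))" "\<And>z. 0 \<le> a z \<and> a z \<le> W"
  shows "W * (3/4 - 2 * ((1 + 4 * (\<integral>x. (b x)\<^sup>2 \<partial>Q)) ^ n - 1)) \<le>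
    (\<integral>z. a z \<partial>PiM {..<n} (\<lambda>_. joint Q (\<lambda>x. \<eta> x + b x))) +
    (\<integral>z. W - a z \<partial>PiM {..<n} (\<lambda>_. joint Q (\<lambda>x. \<eta> x - b x)))"
proof -
  define N where "N = PiM {..<n} (\<lambda>_. joint Q \<eta>)"
  interpret N: prob_space N unfolding N_def by (rule prob_space_sample[OF \<eta>])
  define p where "p z = (\<Prod>i<n. lr b (z i))" for z
  define q where "q z = (\<Prod>i<n. lr (\<lambda>x. - b x) (z i))" for z
  define X where "X = (1 + 4 * (\<integral>x. (b x)\<^sup>2 \<partial>Q)) ^ n"
  note P = likelihood_ratio[OF \<eta> b half a, folded p_def N_def]
  have Wa: "(\<lambda>z. W - a z) \<in> borel_measurable (PiM {..<n} (\<lambda>_. Z_space))" "0 \<le> W - a z \<and> W - a z \<le> W" for z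
    using a by auto
  have nb: "(\<lambda>x. - b x) \<in> borel_measurable borel" "\<bar>- b x\<bar> \<le> 1/2" "- b x \<noteq> 0 \<Longrightarrow> \<eta> x = 1/2" for x
    using b half by auto
  \<comment> \<open>Replacing b by -b leaves the second moment unchanged, so both ratios share the
    value \<open>X\<close>.\<close>
  note Q = likelihood_ratio[OF \<eta> nb Wa, folded q_def N_def, simplified]
  \<comment> \<open>Integrating (p - 1)^2 gives X - 1 by the first two moments, and likewise for
    q.\<close>
  have "W * (3/4 - 2 * (X - 1)) = (\<integral>z. W * (3/4 - (((p z)\<^sup>2 - 2 * p z + 1) + ((q z)\<^sup>2 - 2 * q z + 1))) \<partial>N)"
    using P Q by (simp add: X_def N.prob_space algebra_simps)
  also have "\<dots> \<le> (\<integral>z. p z * a z + q z * (W - a z) \<partial>N)"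
  proof (rule integral_mono)
    show "integrable N (\<lambda>z. W * (3/4 - (((p z)\<^sup>2 - 2 * p z + 1) + ((q z)\<^sup>2 - 2 * q z + 1))))"
      using P Q by auto
    show "integrable N (\<lambda>z. p z * a z + q z * (W - a z))"
      using P Q by auto
    fix z
    show "W * (3/4 - (((p z)\<^sup>2 - 2 * p z + 1) + ((q z)\<^sup>2 - 2 * q z + 1))) \<le> p z * a z + q z * (W - a z)"
      by (rule two_point_pointwise) (use a(2)[of z] in auto)
  qed
  also have "\<dots> = (\<integral>z. p z * a z \<partial>N) + (\<integral>z. q z * (W - a z) \<partial>N)"
    using P(2) Q(2) by (rule Bochner_Integration.integral_add)
  finally show ?thesis
    using P(1) Q(1) by (simp add: X_def)
qed


text \<open>The share of a single bump in the excess risk: y is the Bayes decision on its support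
  and 2b the price |2\<eta> - 1| of a wrong decision.\<close>

definition loss :: "(real^'d \<Rightarrow> real) \<Rightarrow> bool \<Rightarrow> (real^'d \<Rightarrow> bool) \<Rightarrow> real" where
  "loss b y g = (\<integral>x. (if g x \<longleftrightarrow> y then 0 else 2 * b x) \<partial>Q)"

text \<open>Disjoint supports decouple the bumps; where all of them vanish the regression function
  is 1/2 and either decision is free.\<close>

lemma excess_risk_mixture:
  assumes b: "\<And>j. j < m \<Longrightarrow> b j \<in> borel_measurable borel" "\<And>j x. j < m \<Longrightarrow> 0 \<le> b j x \<and> b j x \<le> 1/2"
    and disj: "\<And>i j x. i < m \<Longrightarrow> j < m \<Longrightarrow> b i x \<noteq> 0 \<Longrightarrow> b j x \<noteq> 0 \<Longrightarrow> i = j"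
    and g [measurable]: "Measurable.pred borel g"
  shows "risk (joint Q (mixture m b S)) g - risk (joint Q (mixture m b S)) (bayes_rule (joint Q (mixture m b S))) =
    (\<Sum>j<m. loss (b j) (j \<in> S) g)"
proof -
  have "(if g x \<longleftrightarrow> mixture m b S x \<ge> 1/2 then 0 else \<bar>2 * mixture m b S x - 1\<bar>) =
      (\<Sum>j<m. if g x \<longleftrightarrow> j \<in> S then 0 else 2 * b j x)" for x
  proof (rule mixture_cases[where m = m and b = b and S = S and x = x, OF disj])
    fix j assume j: "j < m" "b j x \<noteq> 0" "\<And>i. i < m \<Longrightarrow> i \<noteq> j \<Longrightarrow> b i x = 0"
      "mixture m b S x = 1/2 + (if j \<in> S then b j x else - b j x)"
    have "(\<Sum>i<m. if g x \<longleftrightarrow> i \<in> S then 0 else 2 * b i x) = (\<Sum>i\<in>{j}. if g x \<longleftrightarrow> i \<in> S then 0 else 2 * b i x)"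
      by (rule sum.mono_neutral_right) (use j in auto)
    moreover have "0 < b j x" using j(1,2) b(2)[of j x] by simp
    ultimately show ?thesis unfolding j(4) by (cases "j \<in> S") simp_all
  next
    assume j: "\<And>j. j < m \<Longrightarrow> b j x = 0" "mixture m b S x = 1/2"
    then have "(\<Sum>j<m. if g x \<longleftrightarrow> j \<in> S then 0 else 2 * b j x) = 0"
      by (intro sum.neutral) auto
    then show ?thesis using j(2) by simp
  qed
  moreover have "risk (joint Q (mixture m b S)) g - risk (joint Q (mixture m b S)) (bayes_rule (joint Q (mixture m b S))) =
      (\<integral>x. (if g x \<longleftrightarrow> mixture m b S x \<ge> 1/2 then 0 else \<bar>2 * mixture m b S x - 1\<bar>) \<partial>Q)"
    by (rule excess_risk_joint[OF is_prob_fun_mixture[OF b disj] g])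
  ultimately have "risk (joint Q (mixture m b S)) g - risk (joint Q (mixture m b S)) (bayes_rule (joint Q (mixture m b S))) =
      (\<integral>x. (\<Sum>j<m. if g x \<longleftrightarrow> j \<in> S then 0 else 2 * b j x) \<partial>Q)"
    by simp
  also have "\<dots> = (\<Sum>j<m. loss (b j) (j \<in> S) g)"
    unfolding loss_def
  proof (rule Bochner_Integration.integral_sum)
    fix j assume j: "j \<in> {..<m}"
    have [measurable]: "b j \<in> borel_measurable borel" using b(1) j by simp
    have "norm (if g x \<longleftrightarrow> j \<in> S then 0 else 2 * b j x) \<le> 1" for x
      using b(2)[of j x] j by auto
    then show "integrable Q (\<lambda>x. if g x \<longleftrightarrow> j \<in> S then 0 else 2 * b j x)"
      by (intro integrable_const_bound[where B = 1]) (auto simp del: real_norm_def)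
  qed
  finally show ?thesis .
qed

text \<open>At every point exactly one of the two signs makes the decision wrong, so the losses for
  the two signs add up to the integral of 2b: the complementary form a, W - a of the two-point
  bound. Joint measurability of the classifier makes the loss measurable in the sample.\<close>

lemma loss_classifier:
  assumes f: "is_classifier n f" and b: "b \<in> borel_measurable borel" "\<And>x. 0 \<le> b x \<and> b x \<le> 1/2"
  shows "(\<lambda>z. loss b y (f z)) \<in> borel_measurable (PiM {..<n} (\<lambda>_. Z_space))"
    and "z \<in> space (PiM {..<n} (\<lambda>_. Z_space)) \<Longrightarrow> Measurable.pred borel (f z)"
    and "0 \<le> loss b y g" and "loss b y g \<le> (\<integral>x. 2 * b x \<partial>Q)"
    and "z \<in> space (PiM {..<n} (\<lambda>_. Z_space)) \<Longrightarrow> loss b False (f z) = (\<integral>x. 2 * b x \<partial>Q) - loss b True (f z)"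
proof -
  let ?Z = "PiM {..<n} (\<lambda>_. Z_space :: ((real^'d) \<times> bool) measure)"
  have f' [measurable]: "(\<lambda>(z, x). f z x) \<in> ?Z \<Otimes>\<^sub>M borel \<rightarrow>\<^sub>M count_space UNIV"
    using f by (simp add: is_classifier_def)
  have sets_eq: "sets (?Z \<Otimes>\<^sub>M Q) = sets (?Z \<Otimes>\<^sub>M borel)"
    by (intro sets_pair_measure_cong) auto
  note bm [measurable] = b(1)
  have "(\<lambda>(z, x). if f z x \<longleftrightarrow> y then 0 else 2 * b x) \<in> borel_measurable (?Z \<Otimes>\<^sub>M Q)"
    unfolding measurable_cong_sets[OF sets_eq refl] by measurable
  then show "(\<lambda>z. loss b y (f z)) \<in> borel_measurable ?Z"
    unfolding loss_def by (rule borel_measurable_lebesgue_integral)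
  have b_le: "norm (2 * b x) \<le> 1" "norm (if f z x \<longleftrightarrow> True then 0 else 2 * b x) \<le> 1" for x
    using b(2)[of x] by auto
  have int_b: "integrable Q (\<lambda>x. 2 * b x)"
    by (rule integrable_const_bound[where B = 1]) (use b_le in \<open>auto simp del: real_norm_def\<close>)
  show "0 \<le> loss b y g"
    unfolding loss_def using b by (intro Bochner_Integration.integral_nonneg) auto
  show "loss b y g \<le> (\<integral>x. 2 * b x \<partial>Q)"
    unfolding loss_def using b by (intro integral_mono' int_b) auto
  assume z: "z \<in> space ?Z"
  show fz [measurable]: "Measurable.pred borel (f z)"
    using measurable_compose[OF measurable_Pair1'[OF z] f'] by simp
  have "loss b False (f z) = (\<integral>x. 2 * b x - (if f z x \<longleftrightarrow> True then 0 else 2 * b x) \<partial>Q)"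
    unfolding loss_def by (intro Bochner_Integration.integral_cong) auto
  also have "\<dots> = (\<integral>x. 2 * b x \<partial>Q) - loss b True (f z)"
    unfolding loss_def
  proof (rule Bochner_Integration.integral_diff[OF int_b])
    show "integrable Q (\<lambda>x. if f z x \<longleftrightarrow> True then 0 else 2 * b x)"
      by (rule integrable_const_bound[where B = 1]) (use b_le(2) in \<open>auto simp del: real_norm_def\<close>)
  qed
  finally show "loss b False (f z) = (\<integral>x. 2 * b x \<partial>Q) - loss b True (f z)" .
qed

text \<open>Assouad's argument: average the excess risk over all sign patterns, and pair the patterns that
  differ in a single sign.\<close>

lemma assouad:
  assumes f: "is_classifier n f"
    and b: "\<And>j. j < m \<Longrightarrow> b j \<in> borel_measurable borel" "\<And>j x. j < m \<Longrightarrow> 0 \<le> b j x \<and> b j x \<le> 1/2"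
    and disj: "\<And>i j x. i < m \<Longrightarrow> j < m \<Longrightarrow> b i x \<noteq> 0 \<Longrightarrow> b j x \<noteq> 0 \<Longrightarrow> i = j"
    and small: "\<And>j. j < m \<Longrightarrow> (1 + 4 * (\<integral>x. (b j x)\<^sup>2 \<partial>Q)) ^ n \<le> 9/8"
  obtains S where "expected_risk n (joint Q (mixture m b S)) f -
      risk (joint Q (mixture m b S)) (bayes_rule (joint Q (mixture m b S))) \<ge> 1/2 * (\<Sum>j<m. \<integral>x. b j x \<partial>Q)"
proof -
  define J where "J S = joint Q (mixture m b S)" for S
  define N where "N S = PiM {..<n} (\<lambda>_. J S)" for S
  define E where "E S j = (\<integral>z. loss (b j) (j \<in> S) (f z) \<partial>N S)" for S j
  define V where "V S = expected_risk n (J S) f - risk (J S) (bayes_rule (J S))" for S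
  have mix: "is_prob_fun (mixture m b S)" for S
    by (rule is_prob_fun_mixture[OF b disj])
  have N: "prob_space (N S)" for S
    unfolding N_def J_def by (rule prob_space_sample[OF mix])
  have sets_N: "sets (N S) = sets (PiM {..<n} (\<lambda>_. Z_space))" for S
    unfolding N_def J_def by (rule sets_sample)
  note space_N = sets_eq_imp_space_eq[OF sets_N]
  have loss_int: "integrable (N S) (\<lambda>z. loss (b j) y (f z))" if "j < m" for S j y
  proof (rule finite_measure.integrable_const_bound)
    show "finite_measure (N S)" using N by (simp add: prob_space_def)
    show "(\<lambda>z. loss (b j) y (f z)) \<in> borel_measurable (N S)"
      using loss_classifier(1)[OF f b[OF that]] by (simp add: measurable_cong_sets[OF sets_N refl])
    show "AE z in N S. norm (loss (b j) y (f z)) \<le> (\<integral>x. 2 * b j x \<partial>Q)"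
      using loss_classifier(3,4)[OF f b[OF that]] by auto
  qed
  have V: "V S = (\<Sum>j<m. E S j)" for S
  proof -
    interpret N: prob_space "N S" by (rule N)
    let ?c = "risk (J S) (bayes_rule (J S))"
    have "expected_risk n (J S) f = (\<integral>z. ?c + (\<Sum>j<m. loss (b j) (j \<in> S) (f z)) \<partial>N S)"
      unfolding expected_risk_def N_def[symmetric]
    proof (rule Bochner_Integration.integral_cong)
      fix z assume "z \<in> space (N S)"
      then have "Measurable.pred borel (f z)"
        using f measurable_compose[OF measurable_Pair1', of z "PiM {..<n} (\<lambda>_. Z_space)" "\<lambda>(z, x). f z x" borel]
        by (simp add: space_N is_classifier_def)
      then have "risk (J S) (f z) - ?c = (\<Sum>j<m. loss (b j) (j \<in> S) (f z))"
        unfolding J_def by (intro excess_risk_mixture[OF b disj])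
      then show "risk (J S) (f z) = ?c + (\<Sum>j<m. loss (b j) (j \<in> S) (f z))"
        by simp
    qed simp
    also have "\<dots> = ?c + (\<Sum>j<m. E S j)"
    proof (subst Bochner_Integration.integral_add)
      show "integrable (N S) (\<lambda>z. \<Sum>j<m. loss (b j) (j \<in> S) (f z))"
        by (rule Bochner_Integration.integrable_sum) (simp add: loss_int)
      have "(\<integral>z. (\<Sum>j<m. loss (b j) (j \<in> S) (f z)) \<partial>N S) = (\<Sum>j<m. E S j)"
        unfolding E_def by (rule Bochner_Integration.integral_sum) (simp add: loss_int)
      then show "(\<integral>z. ?c \<partial>N S) + (\<integral>z. (\<Sum>j<m. loss (b j) (j \<in> S) (f z)) \<partial>N S) = ?c + (\<Sum>j<m. E S j)"
        by (simp add: N.prob_space)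
    qed simp
    finally show ?thesis by (simp add: V_def)
  qed
  define W where "W j = (\<integral>x. 2 * b j x \<partial>Q)" for j
  have pair: "W j / 2 \<le> E S j + E (S - {j}) j" if j: "j < m" and jS: "j \<in> S" for S j
  proof -
    \<comment> \<open>The midpoint of the two patterns: bump j is deleted and the other signs are
      kept. On the support of \<open>b j\<close> the other bumps vanish, so \<eta> = 1/2 there, as
      the two-point bound requires.\<close>
    define \<eta> where "\<eta> = mixture m (b(j := \<lambda>_. 0)) S"
    have \<eta>: "is_prob_fun \<eta>"
      unfolding \<eta>_def by (rule is_prob_fun_mixture) (use b disj in \<open>auto split: if_splits\<close>)
    have rest: "(\<Sum>i\<in>{..<m} - {j}. if i \<in> T then (b(j := \<lambda>_. 0)) i x else - (b(j := \<lambda>_. 0)) i x) =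
        (\<Sum>i\<in>{..<m} - {j}. if i \<in> S then b i x else - b i x)" if "T - {j} = S - {j}" for T x
      using that by (intro sum.cong) auto
    have \<eta>_eq: "\<eta> x = 1/2 + (\<Sum>i\<in>{..<m} - {j}. if i \<in> S then b i x else - b i x)" for x
      unfolding \<eta>_def mixture_def using j rest[of S] by (subst sum.remove[of _ j]) auto
    have plus: "mixture m b S = (\<lambda>x. \<eta> x + b j x)"
      unfolding mixture_def \<eta>_eq using j jS by (subst sum.remove[of _ j]) auto
    have minus: "mixture m b (S - {j}) = (\<lambda>x. \<eta> x - b j x)"
    proof
      fix x
      have "(\<Sum>i\<in>{..<m} - {j}. if i \<in> S - {j} then b i x else - b i x) =
          (\<Sum>i\<in>{..<m} - {j}. if i \<in> S then b i x else - b i x)"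
        by (intro sum.cong) auto
      then show "mixture m b (S - {j}) x = \<eta> x - b j x"
        unfolding mixture_def \<eta>_eq using j by (subst sum.remove[of _ j]) auto
    qed
    have half: "\<eta> x = 1/2" if "b j x \<noteq> 0" for x
      unfolding \<eta>_eq using disj[OF _ j _ that] by (subst sum.neutral) auto
    have "W j * (3/4 - 2 * ((1 + 4 * (\<integral>x. (b j x)\<^sup>2 \<partial>Q)) ^ n - 1)) \<le>
      (\<integral>z. loss (b j) True (f z) \<partial>PiM {..<n} (\<lambda>_. joint Q (\<lambda>x. \<eta> x + b j x))) +
      (\<integral>z. W j - loss (b j) True (f z) \<partial>PiM {..<n} (\<lambda>_. joint Q (\<lambda>x. \<eta> x - b j x)))"
    proof (rule two_point_bound[OF \<eta> b(1)[OF j]])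
      show "\<bar>b j x\<bar> \<le> 1/2" for x using b(2)[OF j, of x] by simp
    qed (use loss_classifier(1,3,4)[OF f b[OF j]] half in \<open>auto simp: W_def\<close>)
    also have "(\<integral>z. loss (b j) True (f z) \<partial>PiM {..<n} (\<lambda>_. joint Q (\<lambda>x. \<eta> x + b j x))) = E S j"
      using jS by (simp add: E_def N_def J_def plus)
    also have "(\<integral>z. W j - loss (b j) True (f z) \<partial>PiM {..<n} (\<lambda>_. joint Q (\<lambda>x. \<eta> x - b j x))) = E (S - {j}) j"
      unfolding E_def minus[symmetric] J_def[symmetric] N_def[symmetric]
      using loss_classifier(5)[OF f b[OF j]]
      by (intro Bochner_Integration.integral_cong) (auto simp: W_def space_N)
    finally have "W j * (3/4 - 2 * ((1 + 4 * (\<integral>x. (b j x)\<^sup>2 \<partial>Q)) ^ n - 1)) \<le> E S j + E (S - {j}) j" .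
    \<comment> \<open>3/4 - 2 * (9/8 - 1) = 1/2, which explains the threshold 9/8.\<close>
    moreover have "W j * (1/2) \<le> W j * (3/4 - 2 * ((1 + 4 * (\<integral>x. (b j x)\<^sup>2 \<partial>Q)) ^ n - 1))"
      using small[OF j] b(2)[OF j] unfolding W_def
      by (intro mult_left_mono Bochner_Integration.integral_nonneg) auto
    ultimately show ?thesis by linarith
  qed
  \<comment> \<open>Toggling j is an involution of the power set of \<open>{..<m}\<close>, so
    summing the pair bound over all patterns counts each value of E twice; hence W j / 4
    below.\<close>
  define flip where "flip j S = (if j \<in> S then S - {j} else insert j S)" for j :: nat and S
  have "2 ^ m * (W j / 4) \<le> (\<Sum>S\<in>Pow {..<m}. E S j)" if j: "j < m" for j
  proof -
    have "(\<Sum>S\<in>Pow {..<m}. E (flip j S) j) = (\<Sum>S\<in>Pow {..<m}. E S j)"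
      by (rule sum.reindex_bij_witness[where i = "flip j" and j = "flip j"]) (use j in \<open>auto simp: flip_def\<close>)
    moreover have "(\<Sum>S\<in>Pow {..<m}. W j / 2) \<le> (\<Sum>S\<in>Pow {..<m}. E S j + E (flip j S) j)"
    proof (rule sum_mono)
      fix S
      have "W j / 2 \<le> E T j + E (T - {j}) j" if "j \<in> T" for T
        using j that by (rule pair)
      from this[of S] this[of "insert j S"]
      show "W j / 2 \<le> E S j + E (flip j S) j"
        by (cases "j \<in> S") (auto simp: flip_def add.commute)
    qed
    ultimately show ?thesis
      by (simp add: sum.distrib card_Pow)
  qed
  then have "(\<Sum>j<m. 2 ^ m * (W j / 4)) \<le> (\<Sum>j<m. \<Sum>S\<in>Pow {..<m}. E S j)"
    by (intro sum_mono) auto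
  also have "\<dots> = (\<Sum>S\<in>Pow {..<m}. V S)"
    unfolding V by (rule sum.swap)
  finally have total: "2 ^ m * (\<Sum>j<m. W j / 4) \<le> (\<Sum>S\<in>Pow {..<m}. V S)"
    by (simp add: sum_distrib_left)
  \<comment> \<open>Some pattern is at least as bad as the average over all 2^m of them.\<close>
  have "\<exists>S\<in>Pow {..<m}. (\<Sum>j<m. W j / 4) \<le> V S"
  proof (rule ccontr)
    assume "\<not> ?thesis"
    then have "V S < (\<Sum>j<m. W j / 4)" if "S \<in> Pow {..<m}" for S
      using that by (meson not_le)
    then have "(\<Sum>S\<in>Pow {..<m}. V S) < (\<Sum>S\<in>Pow {..<m}. (\<Sum>j<m. W j / 4))"
      by (intro sum_strict_mono) blast+
    then show False using total by (simp add: card_Pow)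
  qed
  moreover have "(\<Sum>j<m. W j / 4) = 1/2 * (\<Sum>j<m. \<integral>x. b j x \<partial>Q)"
    by (simp add: W_def sum_distrib_left)
  ultimately show thesis
    using that unfolding V_def J_def by auto
qed

end

section \<open>Hard configurations\<close>

text \<open>Greedy choice: while the volume condition holds, the closed balls of radius r around the
  centres chosen so far cannot cover S, and any uncovered point can be added.\<close>

lemma packing:
  fixes S :: "(real^'d::finite) set"
  assumes S: "S \<in> sets borel" "bounded S" and r: "r \<ge> 0"
    and m: "real m * (unit_ball_vol CARD('d) * r ^ CARD('d)) < measure lborel S"
  shows "\<exists>c :: nat \<Rightarrow> real^'d. (\<forall>j<m. c j \<in> S) \<and> (\<forall>i<m. \<forall>j<m. i \<noteq> j \<longrightarrow> dist (c i) (c j) > r)"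
  using m
proof (induction m)
  case (Suc m)
  let ?v = "unit_ball_vol CARD('d) * r ^ CARD('d)"
  have "real m * ?v \<le> real (Suc m) * ?v"
    using r by (intro mult_right_mono) auto
  then have less: "real m * ?v < measure lborel S"
    using Suc.prems by linarith
  then obtain c where c: "\<forall>j<m. c j \<in> S" "\<forall>i<m. \<forall>j<m. i \<noteq> j \<longrightarrow> dist (c i) (c j) > r"
    using Suc.IH[OF less] by blast
  have "\<not> S \<subseteq> (\<Union>j<m. cball (c j) r)"
  proof
    assume sub: "S \<subseteq> (\<Union>j<m. cball (c j) r)"
    have "measure lborel S \<le> measure lborel (\<Union>j<m. cball (c j) r)"
      using S sub by (intro measure_mono_fmeasurable) (auto intro!: fmeasurable_compact compact_UN)
    also have "\<dots> \<le> (\<Sum>j<m. measure lborel (cball (c j) r))"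
      by (rule measure_UNION_le) auto
    also have "\<dots> = real m * ?v"
      using r by (simp add: content_cball)
    also have "\<dots> < measure lborel S" by fact
    finally show False by simp
  qed
  then obtain x where x: "x \<in> S" "\<And>j. j < m \<Longrightarrow> dist (c j) x > r"
    by (auto simp: subset_eq not_le)
  show ?case
    using c x by (intro exI[of _ "c(m := x)"]) (auto simp: less_Suc_eq dist_commute)
qed simp

section \<open>Probability densities that are constant on disjoint pieces\<close>

definition piecewise_uniform :: "'i set \<Rightarrow> ('i \<Rightarrow> real) \<Rightarrow> ('i \<Rightarrow> (real^'d::finite) set) \<Rightarrow> real^'d \<Rightarrow> real" where
  "piecewise_uniform I p T x = (\<Sum>i\<in>I. p i / measure lborel (T i) * indicator (T i) x)"

context
  fixes I :: "'i set" and p :: "'i \<Rightarrow> real" and T :: "'i \<Rightarrow> (real^'d::finite) set"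
  assumes I: "finite I" and p: "\<And>i. i \<in> I \<Longrightarrow> 0 \<le> p i" "sum p I = 1"
    and T: "\<And>i. i \<in> I \<Longrightarrow> T i \<in> sets borel" "\<And>i. i \<in> I \<Longrightarrow> bounded (T i)"
      "\<And>i. i \<in> I \<Longrightarrow> measure lborel (T i) > 0"
    and disj: "disjoint_family_on T I"
begin

lemma piecewise_uniform_eq:
  assumes "i \<in> I" "x \<in> T i"
  shows "piecewise_uniform I p T x = p i / measure lborel (T i)"
proof -
  have "piecewise_uniform I p T x = (\<Sum>j\<in>{i}. p j / measure lborel (T j) * indicator (T j) x)"
    unfolding piecewise_uniform_def
    by (rule sum.mono_neutral_right) (use I assms disj in \<open>auto simp: disjoint_family_on_def indicator_def\<close>)
  then show ?thesis using assms by simp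
qed

lemma piecewise_uniform_eq_0: "x \<notin> (\<Union>i\<in>I. T i) \<Longrightarrow> piecewise_uniform I p T x = 0"
  unfolding piecewise_uniform_def by (intro sum.neutral) auto

lemma piecewise_uniform_nonneg: "0 \<le> piecewise_uniform I p T x"
  unfolding piecewise_uniform_def using p by (intro sum_nonneg mult_nonneg_nonneg) auto

lemma piecewise_uniform_measurable [measurable]: "piecewise_uniform I p T \<in> borel_measurable borel"
  unfolding piecewise_uniform_def using T(1) by (intro borel_measurable_sum borel_measurable_times) auto

lemma emeasure_piecewise_uniform:
  assumes i: "i \<in> I"
  shows "emeasure (density lborel (\<lambda>x. ennreal (piecewise_uniform I p T x))) (T i) = ennreal (p i)"
proof -
  note [measurable] = T(1)[OF i]
  have "emeasure (density lborel (\<lambda>x. ennreal (piecewise_uniform I p T x))) (T i) =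
      (\<integral>\<^sup>+x. ennreal (p i / measure lborel (T i)) * indicator (T i) x \<partial>lborel)"
    by (subst emeasure_density)
      (auto simp: piecewise_uniform_eq[OF i] indicator_def intro!: nn_integral_cong)
  also have "\<dots> = ennreal (p i / measure lborel (T i)) * emeasure lborel (T i)"
    by (rule nn_integral_cmult_indicator) simp
  also have "emeasure lborel (T i) = ennreal (measure lborel (T i))"
    using emeasure_bounded_finite[OF T(2)[OF i]] by (simp add: emeasure_eq_ennreal_measure)
  also have "ennreal (p i / measure lborel (T i)) * \<dots> = ennreal (p i)"
    using T(3)[OF i] p(1)[OF i] by (simp add: ennreal_mult[symmetric])
  finally show ?thesis .
qed

lemma design_measure_piecewise_uniform:
  "design_measure (density lborel (\<lambda>x. ennreal (piecewise_uniform I p T x)))"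
proof (intro design_measure.intro design_measure_axioms.intro prob_spaceI)
  let ?Q = "density lborel (\<lambda>x. ennreal (piecewise_uniform I p T x))"
  have U: "(\<Union>i\<in>I. T i) \<in> sets borel" using I T(1) by auto
  have "emeasure ?Q (space ?Q) = emeasure ?Q (\<Union>i\<in>I. T i)"
    using U by (subst (1 2) emeasure_density)
      (auto intro!: nn_integral_cong simp: indicator_def piecewise_uniform_eq_0)
  also have "\<dots> = (\<Sum>i\<in>I. emeasure ?Q (T i))"
    using I T(1) disj by (intro sum_emeasure[symmetric]) auto
  also have "\<dots> = (\<Sum>i\<in>I. ennreal (p i))"
    by (intro sum.cong refl emeasure_piecewise_uniform)
  also have "\<dots> = 1"
    using p by (simp add: sum_ennreal)
  finally show "emeasure ?Q (space ?Q) = 1" .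
qed simp

lemma AE_piecewise_uniform:
  "AE x in density lborel (\<lambda>x. ennreal (piecewise_uniform I p T x)). x \<in> (\<Union>i\<in>I. T i)"
proof (subst AE_density)
  show "AE x in lborel. 0 < ennreal (piecewise_uniform I p T x) \<longrightarrow> x \<in> (\<Union>i\<in>I. T i)"
    by (rule AE_I2) (metis ennreal_0 less_irrefl piecewise_uniform_eq_0)
qed simp

end

text \<open>The parameters 1/\<delta> and -c/\<delta> of \<open>cube_bump\<close> put its cube
  around c with half side \<delta>.\<close>

lemma cube_bump_scaled_arg: "\<delta> > 0 \<Longrightarrow> \<bar>1 / \<delta> * x $ i + (- (1 / \<delta>) *\<^sub>R c) $ i\<bar> = \<bar>x $ i - c $ i\<bar> / \<delta>"
  by (simp add: diff_divide_distrib[symmetric] abs_divide)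

text \<open>The density may vanish on part of the regular set \<open>A\<close>, so the pieces that carry the mass need
  not be regular themselves.\<close>

lemma lower_bound_configuration:
  fixes A :: "(real^'d::finite) set" and c :: "nat \<Rightarrow> real^'d" and \<beta> L h \<delta> :: real
  defines "\<kappa> \<equiv> (3/4 :: real) ^ ((strict_floor \<beta> + 3) * CARD('d))"
  defines "bmp \<equiv> \<lambda>j x. h * cube_bump (strict_floor \<beta> + 3) (1 / \<delta>) (- (1 / \<delta>) *\<^sub>R c j) x"
  assumes A: "compact A" "regular_set c0 r0 A" "A \<subseteq> K"
    and rest: "\<mu>max * measure lborel (A - cball x0 (2 * \<rho>)) \<ge> 1" "\<mu>max > 0"
    and \<delta>: "\<delta> > 0" "real CARD('d) * \<delta> \<le> \<rho>"
    and c: "\<And>j. j < m \<Longrightarrow> c j \<in> cball x0 \<rho>"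
      "\<And>i j. i < m \<Longrightarrow> j < m \<Longrightarrow> i \<noteq> j \<Longrightarrow> dist (c i) (c j) > 2 * real CARD('d) * \<delta>"
    and \<omega>: "\<omega> > 0" "real m * \<omega> \<le> 1" "real m * \<omega> \<le> C0 * (\<kappa> * h) powr \<alpha>"
      "\<And>j. j < m \<Longrightarrow> \<omega> \<le> \<mu>max * measure lborel (A \<inter> cball (c j) (\<delta> / 2))"
    and h: "0 < h" "h \<le> 1/2" "(1 + 4 * (h\<^sup>2 * \<omega>)) ^ n \<le> 9/8"
    and pos: "C0 > 0" "\<alpha> > 0"
    and hoelder: "\<And>S. mixture m bmp S \<in> Hoelder_class \<beta> L"
    and f: "is_classifier n f"
  shows "\<exists>P\<in>P_Sigma' \<alpha> C0 \<beta> L c0 r0 \<mu>max K.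
    expected_risk n P f - risk P (bayes_rule P) \<ge> 1/2 * (real m * (\<kappa> * h * \<omega>))"
proof -
  define R where "R = A - cball x0 (2 * \<rho>)"
  \<comment> \<open>Index m stands for the remainder R, so \<open>{..m}\<close> enumerates the m
    cells together with R.\<close>
  define T where "T j = (if j < m then A \<inter> cball (c j) (\<delta> / 2) else R)" for j
  define p where "p j = (if j < m then \<omega> else 1 - real m * \<omega>)" for j
  define \<mu> where "\<mu> = piecewise_uniform {..m} p T"
  define Q where "Q = density lborel (\<lambda>x. ennreal (\<mu> x))"
  have \<kappa>: "0 < \<kappa>" by (simp add: \<kappa>_def)
  \<comment> \<open>The Euclidean norm is at most the l1 norm, so a cube of half side \<delta> lies
    in the ball of radius d * \<delta>; this fixes the separation 2 * d * \<delta> of the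
    centres.\<close>
  have cube_bound: "dist x (c j) \<le> real CARD('d) * \<delta>" if "\<And>i. \<bar>x $ i - c j $ i\<bar> \<le> \<delta>" for x j
  proof -
    have "dist x (c j) \<le> (\<Sum>i\<in>UNIV. \<bar>(x - c j) $ i\<bar>)"
      unfolding dist_norm by (rule norm_le_l1_cart)
    also have "\<dots> \<le> (\<Sum>i\<in>(UNIV::'d set). \<delta>)"
      by (rule sum_mono) (use that in simp)
    finally show ?thesis by simp
  qed
  have bmp_nonzero: "\<bar>x $ i - c j $ i\<bar> \<le> \<delta>" if "bmp j x \<noteq> 0" for x j i
  proof (rule ccontr)
    assume "\<not> ?thesis"
    then have "1 \<le> \<bar>1 / \<delta> * x $ i + (- (1 / \<delta>) *\<^sub>R c j) $ i\<bar>"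
      using \<delta> by (simp only: cube_bump_scaled_arg) (simp add: field_simps)
    then have "bmp j x = 0" unfolding bmp_def by (simp add: cube_bump_eq_0)
    then show False using that by simp
  qed
  have cube_disj: "i = j" if ij: "i < m" "j < m" and x: "dist x (c i) \<le> real CARD('d) * \<delta>" "dist x (c j) \<le> real CARD('d) * \<delta>" for i j x
    using c(2)[OF ij] dist_triangle2[of "c i" "c j" x] x by (force simp: dist_commute)
  have T_dist: "dist x (c j) \<le> real CARD('d) * \<delta>" if "x \<in> T j" "j < m" for x j
  proof -
    have "dist x (c j) \<le> \<delta> / 2" using that by (auto simp: T_def dist_commute)
    also have "\<dots> \<le> 1 * \<delta>" using \<delta> by simp
    also have "\<dots> \<le> real CARD('d) * \<delta>" using \<delta> by (intro mult_right_mono) (auto simp: Suc_leI)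
    finally show ?thesis .
  qed
  \<comment> \<open>One \<rho> for the distance of the centre from x0 and one for the extent of its
    cube: hence the radius 2 * \<rho> of the removed ball.\<close>
  have near_x0: "x \<in> cball x0 (2 * \<rho>)" if "j < m" "dist x (c j) \<le> real CARD('d) * \<delta>" for x j
    using c(1)[OF that(1)] dist_triangle[of x0 x "c j"] that(2) \<delta>(2) by (auto simp: dist_commute)
  have bmp_R: "bmp j x = 0" if "j < m" "x \<in> R" for j x
    using near_x0[OF that(1) cube_bound] bmp_nonzero that(2) by (auto simp: R_def)
  have bmp_T: "bmp i x = 0" if "i < m" "j < m" "i \<noteq> j" "x \<in> T j" for i j x
    using cube_disj[OF that(1,2) cube_bound T_dist[OF that(4,2)]] bmp_nonzero that(3) by blast
  have bmp_disj: "i = j" if "i < m" "j < m" "bmp i x \<noteq> 0" "bmp j x \<noteq> 0" for i j x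
    using cube_disj[OF that(1,2)] cube_bound bmp_nonzero that(3,4) by blast
  have bmp_bounds: "0 \<le> bmp j x" "bmp j x \<le> h" for j x
    using h cube_bump_nonneg cube_bump_le_1 unfolding bmp_def
    by (auto intro!: mult_nonneg_nonneg mult_left_le)
  have bmp_half: "0 \<le> bmp j x \<and> bmp j x \<le> 1/2" for j x
    using bmp_bounds[of j x] h(2) by linarith
  have bmp_ge: "\<kappa> * h \<le> bmp j x" if "j < m" "x \<in> T j" for j x
  proof -
    have "dist x (c j) \<le> \<delta> / 2" using that by (auto simp: T_def dist_commute)
    then have "\<bar>x $ i - c j $ i\<bar> / \<delta> \<le> 1/2" for i
      using component_le_norm_cart[of "x - c j" i] \<delta> by (simp add: dist_norm field_simps)
    then have "\<kappa> \<le> cube_bump (strict_floor \<beta> + 3) (1 / \<delta>) (- (1 / \<delta>) *\<^sub>R c j) x"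
      unfolding \<kappa>_def using \<delta> by (intro cube_bump_ge) (simp only: cube_bump_scaled_arg)
    then show ?thesis
      unfolding bmp_def using h by (simp add: mult.commute)
  qed
  have bmp_meas [measurable]: "bmp j \<in> borel_measurable borel" for j
  proof -
    have "continuous_on UNIV (cube_bump (strict_floor \<beta> + 3) (1 / \<delta>) (- (1 / \<delta>) *\<^sub>R c j))"
      using cont_diff_mono[OF cont_diff_cube_bump[of "Suc (strict_floor \<beta>)"], of 0]
      by (simp add: eval_nat_numeral)
    then show ?thesis
      unfolding bmp_def by (intro borel_measurable_times borel_measurable_const borel_measurable_continuous_onI)
  qed
  have measR: "measure lborel R > 0"
    using rest by (metis R_def less_le_not_le linorder_not_less mult_nonneg_nonpos order.trans zero_less_one less_imp_le)
  have T: "T j \<in> sets borel" "bounded (T j)" "measure lborel (T j) > 0" for j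
  proof -
    have "closed A" using A(1) by (rule compact_imp_closed)
    then show "T j \<in> sets borel" by (auto simp: T_def R_def)
    show "bounded (T j)"
      using compact_imp_bounded[OF A(1)] by (auto simp: T_def R_def intro: bounded_subset)
    show "measure lborel (T j) > 0"
    proof (cases "j < m")
      case True
      have "0 < \<mu>max * measure lborel (A \<inter> cball (c j) (\<delta> / 2))"
        using \<omega>(1) \<omega>(4)[OF True] by linarith
      then show ?thesis using True rest(2) by (simp add: T_def zero_less_mult_iff)
    qed (use measR in \<open>simp add: T_def\<close>)
  qed
  have p: "0 \<le> p j" "sum p {..m} = 1" for j
    using \<omega> by (auto simp: p_def lessThan_Suc_atMost[symmetric])
  have disjT: "disjoint_family_on T {..m}"
    unfolding disjoint_family_on_def
  proof (intro ballI impI)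
    fix i j assume ij: "i \<in> {..m}" "j \<in> {..m}" "i \<noteq> j"
    have "T i \<inter> R = {}" if "i < m" for i
      using near_x0[OF that T_dist[OF _ that]] by (auto simp: R_def)
    moreover have "T i \<inter> T j = {}" if "i < m" "j < m"
      using cube_disj[OF that] T_dist that ij(3) by blast
    moreover have "T m = R" by (simp add: T_def)
    moreover have "i < m \<or> i = m" "j < m \<or> j = m" using ij by auto
    ultimately show "T i \<inter> T j = {}"
      using ij(3) by (metis Int_commute)
  qed
  note pu = finite_atMost[of m] p(1) p(2) T disjT
  interpret Q: design_measure Q
    unfolding Q_def \<mu>_def by (rule design_measure_piecewise_uniform) (use pu in auto)
  have Q_T: "measure Q (T j) = \<omega>" if "j < m" for j
  proof -
    have "emeasure Q (T j) = ennreal (p j)"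
      unfolding Q_def \<mu>_def by (rule emeasure_piecewise_uniform) (use pu that in auto)
    then show ?thesis using that \<omega>(1) by (simp add: measure_def p_def)
  qed
  have AE_T: "AE x in Q. (\<exists>j<m. x \<in> T j) \<or> x \<in> R"
  proof -
    have "AE x in Q. x \<in> (\<Union>j\<in>{..m}. T j)"
      unfolding Q_def \<mu>_def by (rule AE_piecewise_uniform) (use pu in auto)
    then show ?thesis
      by eventually_elim (auto simp: T_def split: if_splits)
  qed
  have \<mu>_le: "\<mu> x \<le> \<mu>max" for x
  proof (cases "x \<in> (\<Union>j\<in>{..m}. T j)")
    case True
    then obtain j where j: "j \<le> m" "x \<in> T j" by auto
    then have "\<mu> x = p j / measure lborel (T j)"
      unfolding \<mu>_def by (intro piecewise_uniform_eq) (use pu in auto)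
    moreover have "p j \<le> \<mu>max * measure lborel (T j)"
    proof (cases "j < m")
      case True then show ?thesis using \<omega>(4) by (simp add: p_def T_def)
    next
      case False
      have "0 \<le> real m * \<omega>" using \<omega>(1) by simp
      then have "p j \<le> 1" using False by (simp add: p_def)
      then show ?thesis using False rest(1) by (simp add: T_def R_def)
    qed
    ultimately show ?thesis using T(3)[of j] by (simp add: pos_divide_le_eq)
  next
    case False
    then have "\<mu> x = 0"
      unfolding \<mu>_def by (intro piecewise_uniform_eq_0) (use pu in auto)
    then show ?thesis using rest(2) by simp
  qed
  have prob_mix: "is_prob_fun (mixture m bmp S)" for S
    by (rule is_prob_fun_mixture[OF bmp_meas bmp_half bmp_disj])
  have in_class: "joint Q (mixture m bmp S) \<in> P_Sigma' \<alpha> C0 \<beta> L c0 r0 \<mu>max K" for S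
  proof -
    let ?\<eta> = "mixture m bmp S"
    have dev_T: "\<bar>?\<eta> x - 1/2\<bar> = bmp j x" if "j < m" "x \<in> T j" for x j
    proof -
      have "(\<Sum>i<m. if i \<in> S then bmp i x else - bmp i x) = (\<Sum>i\<in>{j}. if i \<in> S then bmp i x else - bmp i x)"
        by (rule sum.mono_neutral_right) (use that bmp_T in auto)
      then show ?thesis using bmp_bounds(1)[of j x] by (simp add: mixture_def)
    qed
    have dev_R: "?\<eta> x = 1/2" if "x \<in> R" for x
      unfolding mixture_def using bmp_R[OF _ that] by (subst sum.neutral) auto
    \<comment> \<open>For t at least \<open>\<kappa> * h\<close> the mass m * \<omega> of all cells
      is small enough. For smaller t the set is null: the marginal only charges the cells, where the
      deviation from 1/2 is at least \<open>\<kappa> * h\<close>, and R, where it is 0.\<close>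
    have margin: "measure Q {x. 0 < \<bar>?\<eta> x - 1/2\<bar> \<and> \<bar>?\<eta> x - 1/2\<bar> \<le> t} \<le> C0 * t powr \<alpha>" if t: "t > 0" for t
    proof (cases "\<kappa> * h \<le> t")
      case True
      have "measure Q {x. 0 < \<bar>?\<eta> x - 1/2\<bar> \<and> \<bar>?\<eta> x - 1/2\<bar> \<le> t} \<le> measure Q (\<Union>j<m. T j)"
      proof (rule Q.finite_measure_mono_AE)
        show "AE x in Q. x \<in> {x. 0 < \<bar>?\<eta> x - 1/2\<bar> \<and> \<bar>?\<eta> x - 1/2\<bar> \<le> t} \<longrightarrow> x \<in> (\<Union>j<m. T j)"
          using AE_T by eventually_elim (auto simp: dev_R)
      qed (use T in auto)
      also have "\<dots> \<le> (\<Sum>j<m. measure Q (T j))"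
        by (rule measure_UNION_le) (use T in auto)
      also have "\<dots> = real m * \<omega>" by (simp add: Q_T)
      also have "\<dots> \<le> C0 * (\<kappa> * h) powr \<alpha>" by fact
      also have "\<dots> \<le> C0 * t powr \<alpha>"
        using True pos \<kappa> h by (intro mult_left_mono powr_mono2) auto
      finally show ?thesis .
    next
      case False
      note [measurable] = is_prob_funD[OF prob_mix[of S]]
      have "AE x in Q. \<not> (0 < \<bar>?\<eta> x - 1/2\<bar> \<and> \<bar>?\<eta> x - 1/2\<bar> \<le> t)"
        using AE_T
      proof eventually_elim
        case (elim x)
        then show ?case
        proof
          assume "\<exists>j<m. x \<in> T j"
          then obtain j where j: "j < m" "x \<in> T j" by blast
          show ?thesis using dev_T[OF j] bmp_ge[OF j] False by linarith
        qed (simp add: dev_R)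
      qed
      then have "measure Q {x. 0 < \<bar>?\<eta> x - 1/2\<bar> \<and> \<bar>?\<eta> x - 1/2\<bar> \<le> t} = 0"
        by (subst Q.prob_eq_0) auto
      then show ?thesis using pos by simp
    qed
    have "margin_assumption \<alpha> C0 (joint Q ?\<eta>)"
      unfolding margin_assumption_def using margin by (simp only: Q.margin_measure_joint[OF prob_mix]) simp
    moreover have "mild_density c0 r0 \<mu>max K (joint Q ?\<eta>)"
      unfolding mild_density_def Q.marginal_joint[OF prob_mix]
    proof (intro exI conjI)
      show "AE x in Q. x \<in> A"
        using AE_T by eventually_elim (auto simp: T_def R_def split: if_splits)
      show "\<mu> \<in> borel_measurable borel"
        unfolding \<mu>_def by (rule piecewise_uniform_measurable) (use pu in auto)
      show "\<forall>x. 0 \<le> \<mu> x"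
        unfolding \<mu>_def by (intro allI piecewise_uniform_nonneg) (use pu in auto)
      show "Q = density lborel (\<lambda>x. ennreal (\<mu> x))" by (rule Q_def)
    qed (use A \<mu>_le in auto)
    ultimately show ?thesis
      unfolding P_Sigma'_def
      using Q.prob_space_joint[OF prob_mix] Q.sets_joint_Z Q.is_regression_joint[OF prob_mix] hoelder by blast
  qed
  have int_bmp: "integrable Q (bmp j)" for j
    by (rule Q.integrable_const_bound[where B = h]) (use bmp_bounds in auto)
  have lower: "\<kappa> * h * \<omega> \<le> (\<integral>x. bmp j x \<partial>Q)" if j: "j < m" for j
  proof -
    have "\<kappa> * h * \<omega> = (\<integral>x. \<kappa> * h * indicator (T j) x \<partial>Q)"
      using T(1)[of j] by (simp add: Q_T[OF j])
    also have "\<dots> \<le> (\<integral>x. bmp j x \<partial>Q)"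
      using bmp_bounds(1) bmp_ge[OF j] by (intro integral_mono' int_bmp) (auto simp: indicator_def)
    finally show ?thesis .
  qed
  have upper: "(\<integral>x. (bmp j x)\<^sup>2 \<partial>Q) \<le> h\<^sup>2 * \<omega>" if j: "j < m" for j
  proof -
    have "(\<integral>x. (bmp j x)\<^sup>2 \<partial>Q) \<le> (\<integral>x. h\<^sup>2 * indicator (T j) x \<partial>Q)"
    proof (rule integral_mono_AE)
      show "integrable Q (\<lambda>x. (bmp j x)\<^sup>2)"
        by (rule Q.integrable_const_bound[where B = "h\<^sup>2"]) (use bmp_bounds in \<open>auto intro!: AE_I2 power_mono\<close>)
      show "integrable Q (\<lambda>x. h\<^sup>2 * indicator (T j) x)"
        using T(1)[of j] by (intro integrable_mult_right Q.integrable_const_bound[where B = 1]) auto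
      \<comment> \<open>The bump extends over its whole cube, beyond \<open>T j\<close>, but the
        marginal has no mass there; hence only an almost everywhere inequality.\<close>
      show "AE x in Q. (bmp j x)\<^sup>2 \<le> h\<^sup>2 * indicator (T j) x"
        using AE_T
      proof eventually_elim
        case (elim x)
        show ?case
        proof (cases "x \<in> T j")
          case True
          then show ?thesis using bmp_bounds by (simp add: power_mono)
        next
          case False
          then have "bmp j x = 0" using elim bmp_R[OF j] bmp_T[OF j] by blast
          then show ?thesis by simp
        qed
      qed
    qed
    also have "\<dots> = h\<^sup>2 * \<omega>"
      using T(1)[of j] by (simp add: Q_T[OF j])
    finally show ?thesis .
  qed
  have small: "(1 + 4 * (\<integral>x. (bmp j x)\<^sup>2 \<partial>Q)) ^ n \<le> 9/8" if j: "j < m" for j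
  proof -
    have "(1 + 4 * (\<integral>x. (bmp j x)\<^sup>2 \<partial>Q)) ^ n \<le> (1 + 4 * (h\<^sup>2 * \<omega>)) ^ n"
    proof (rule power_mono)
      have "0 \<le> (\<integral>x. (bmp j x)\<^sup>2 \<partial>Q)" by (intro Bochner_Integration.integral_nonneg) auto
      then show "0 \<le> 1 + 4 * (\<integral>x. (bmp j x)\<^sup>2 \<partial>Q)" by simp
    qed (use upper[OF j] in simp)
    then show ?thesis using h(3) by linarith
  qed
  obtain S where S: "expected_risk n (joint Q (mixture m bmp S)) f -
      risk (joint Q (mixture m bmp S)) (bayes_rule (joint Q (mixture m bmp S))) \<ge> 1/2 * (\<Sum>j<m. \<integral>x. bmp j x \<partial>Q)"
    by (rule Q.assouad[OF f bmp_meas bmp_half bmp_disj small])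
  have "real m * (\<kappa> * h * \<omega>) = (\<Sum>j<m. \<kappa> * h * \<omega>)" by simp
  also have "\<dots> \<le> (\<Sum>j<m. \<integral>x. bmp j x \<partial>Q)"
    by (rule sum_mono) (simp add: lower)
  finally show ?thesis
    using S in_class[of S] by (intro bexI[of _ "joint Q (mixture m bmp S)"]) linarith+
qed

text \<open>C is fixed before the number, position, width, height and signs of the bumps, so it
  cannot depend on the sample size. Centres of two closed cubes with a common point differ by at
  most 2 * \<delta> in each coordinate, which contradicts the separation through the l1
  norm.\<close>

lemma mixture_in_Hoelder_class:
  fixes \<beta> :: real
  assumes "\<beta> > 0"
  shows "\<exists>C>0. \<forall>(c :: nat \<Rightarrow> real^'d::finite) m \<delta> h L S. \<delta> > 0 \<longrightarrow> h \<ge> 0 \<longrightarrow>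
      (\<forall>i<m. \<forall>j<m. i \<noteq> j \<longrightarrow> dist (c i) (c j) > 2 * real CARD('d) * \<delta>) \<longrightarrow>
      C * h * (1 / \<delta>) powr \<beta> \<le> L \<longrightarrow>
    mixture m (\<lambda>j x. h * cube_bump (strict_floor \<beta> + 3) (1 / \<delta>) (- (1 / \<delta>) *\<^sub>R c j) x) S \<in> Hoelder_class \<beta> L"
proof (rule bump_combination_in_Hoelder_class[where 'j = nat and 'd = 'd, OF assms])
  fix C
  assume C: "C > 0" "\<And>(I :: nat set) a (b :: nat \<Rightarrow> real^'d) w h c L. \<lbrakk>finite I; a > 0; h \<ge> 0; \<And>j. j \<in> I \<Longrightarrow> \<bar>w j\<bar> \<le> h;
     \<And>j l x. \<lbrakk>j \<in> I; l \<in> I; \<And>i. \<bar>a * x $ i + b j $ i\<bar> \<le> 1; \<And>i. \<bar>a * x $ i + b l $ i\<bar> \<le> 1\<rbrakk> \<Longrightarrow> j = l;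
     C * h * a powr \<beta> \<le> L\<rbrakk> \<Longrightarrow>
     (\<lambda>x. c + (\<Sum>j\<in>I. w j * cube_bump (strict_floor \<beta> + 3) a (b j) x)) \<in> Hoelder_class \<beta> L"
  show ?thesis
  proof (intro exI[of _ C] conjI allI impI C(1))
    fix c :: "nat \<Rightarrow> real^'d" and m \<delta> h L S
    assume \<delta>: "\<delta> > 0" and h: "h \<ge> 0" and sep: "\<forall>i<m. \<forall>j<m. i \<noteq> j \<longrightarrow> dist (c i) (c j) > 2 * real CARD('d) * \<delta>"
      and L: "C * h * (1 / \<delta>) powr \<beta> \<le> L"
    have "(\<lambda>x. 1/2 + (\<Sum>j<m. (if j \<in> S then h else - h) *
        cube_bump (strict_floor \<beta> + 3) (1 / \<delta>) (- (1 / \<delta>) *\<^sub>R c j) x)) \<in> Hoelder_class \<beta> L"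
    proof (rule C(2)[where h = h])
      fix j l x
      assume jl: "j \<in> {..<m}" "l \<in> {..<m}"
        and x: "\<And>i. \<bar>1 / \<delta> * x $ i + (- (1 / \<delta>) *\<^sub>R c j) $ i\<bar> \<le> 1" "\<And>i. \<bar>1 / \<delta> * x $ i + (- (1 / \<delta>) *\<^sub>R c l) $ i\<bar> \<le> 1"
      have "\<bar>(c j - c l) $ i\<bar> \<le> 2 * \<delta>" for i
      proof -
        have "\<bar>x $ i - c j $ i\<bar> \<le> \<delta>" "\<bar>x $ i - c l $ i\<bar> \<le> \<delta>"
          using x[of i] \<delta> unfolding cube_bump_scaled_arg[OF \<delta>] by (simp_all add: pos_divide_le_eq)
        then show ?thesis by (simp add: abs_le_iff)
      qed
      then have "(\<Sum>i\<in>UNIV. \<bar>(c j - c l) $ i\<bar>) \<le> (\<Sum>i\<in>(UNIV::'d set). 2 * \<delta>)"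
        by (intro sum_mono)
      then have "dist (c j) (c l) \<le> 2 * real CARD('d) * \<delta>"
        using norm_le_l1_cart[of "c j - c l"] by (simp add: dist_norm)
      then show "j = l" using sep jl by (meson lessThan_iff not_le)
    qed (use \<delta> h L in auto)
    also have "(\<lambda>x. 1/2 + (\<Sum>j<m. (if j \<in> S then h else - h) *
        cube_bump (strict_floor \<beta> + 3) (1 / \<delta>) (- (1 / \<delta>) *\<^sub>R c j) x)) =
      mixture m (\<lambda>j x. h * cube_bump (strict_floor \<beta> + 3) (1 / \<delta>) (- (1 / \<delta>) *\<^sub>R c j) x) S"
      unfolding mixture_def fun_eq_iff by (intro allI arg_cong2[where f = "(+)"] sum.cong) auto
    finally show "mixture m (\<lambda>j x. h * cube_bump (strict_floor \<beta> + 3) (1 / \<delta>) (- (1 / \<delta>) *\<^sub>R c j) x) S \<in> Hoelder_class \<beta> L" .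
  qed
qed

text \<open>Regularity is phrased with the completed measure, densities with \<open>lborel\<close>;
  closed sets are Borel, so the two agree on them.\<close>

lemma measure_lebesgue_closed: "closed S \<Longrightarrow> measure lebesgue S = measure lborel S"
  by (rule measure_completion) simp

text \<open>The slack in the volume inequality pays for a ball of volume at most
  \<open>measure lborel A - 1 / \<mu>max\<close>. What is left of A can still carry all the mass at
  density at most \<open>\<mu>max\<close>.\<close>

lemma shrink_support:
  fixes A :: "(real^'d::finite) set"
  assumes "compact A" "\<mu>max > 0" "\<mu>max * measure lborel A > 1" "r0 > 0"
  obtains \<rho> where "0 < \<rho>" "\<rho> \<le> r0" "\<mu>max * measure lborel (A - cball x (2 * \<rho>)) \<ge> 1"
proof -
  let ?D = "CARD('d)"
  define v where "v = unit_ball_vol (real ?D)"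
  define \<epsilon> where "\<epsilon> = measure lborel A - 1 / \<mu>max"
  have \<epsilon>: "\<epsilon> > 0" using assms by (simp add: \<epsilon>_def field_simps)
  have v: "v > 0" by (simp add: v_def)
  \<comment> \<open>The cap at 1 gives \<rho>^d \<le> \<rho>, so a bound linear in \<rho> controls
    the volume of the ball; the cap at r0 keeps regularity available at radius \<rho>.\<close>
  define \<rho> where "\<rho> = min (min r0 1) (\<epsilon> / (v * 2 ^ ?D))"
  have \<rho>: "0 < \<rho>" "\<rho> \<le> r0" "\<rho> \<le> 1" "\<rho> \<le> \<epsilon> / (v * 2 ^ ?D)"
    using assms \<epsilon> v by (auto simp: \<rho>_def)
  have "\<rho> ^ ?D \<le> \<rho> ^ 1"
    using \<rho> by (intro power_decreasing) (auto simp: Suc_leI)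
  then have "v * (2 * \<rho>) ^ ?D \<le> v * 2 ^ ?D * (\<epsilon> / (v * 2 ^ ?D))"
    using \<rho> v by (simp only: power_mult_distrib mult.assoc[symmetric]) (intro mult_left_mono, auto)
  also have "\<dots> = \<epsilon>" using v by simp
  finally have ball: "measure lborel (cball x (2 * \<rho>)) \<le> \<epsilon>"
    using \<rho> by (simp add: content_cball v_def)
  have A: "closed A" "A - cball x (2 * \<rho>) \<in> fmeasurable lborel"
    using assms fmeasurable_Diff[OF fmeasurable_compact[OF assms(1)]] by (auto intro: compact_imp_closed)
  have "measure lborel A \<le> measure lborel ((A - cball x (2 * \<rho>)) \<union> cball x (2 * \<rho>))"
    using A by (intro measure_mono_fmeasurable) (use assms(1) in \<open>auto intro!: fmeasurable_compact compact_Un\<close>)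
  also have "\<dots> \<le> measure lborel (A - cball x (2 * \<rho>)) + measure lborel (cball x (2 * \<rho>))"
    using A by (intro measure_Un_le) auto
  finally have "1 / \<mu>max \<le> measure lborel (A - cball x (2 * \<rho>))"
    using ball by (simp add: \<epsilon>_def)
  then have "\<mu>max * measure lborel (A - cball x (2 * \<rho>)) \<ge> 1"
    using assms(2) by (simp add: field_simps)
  then show thesis using that \<rho> by blast
qed

text \<open>A density that is at most \<open>\<mu>max\<close> on the set A carrying it has total
  mass at most \<open>\<mu>max * measure lebesgue A\<close>. If this product were below 1 for every
  admissible A, the class would be empty and the supremum, taken in the extended reals, would be
  minus infinity; \<open>nondegenerate\<close> excludes this.\<close>

theorem theorem4p1:
  fixes L \<beta> \<alpha> C0 c0 r0 \<mu>max :: real and K :: "(real^'d::finite) set"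
  assumes "L > 0" and "\<beta> > 0" and "\<alpha> > 0"
    and "C0 > 0" and "c0 > 0" and "r0 > 0" and "\<mu>max > 0" and "compact K"
    and nondegenerate:
      "\<exists>A\<subseteq>K. compact A \<and> regular_set c0 r0 A \<and> \<mu>max * measure lebesgue A > 1"
  shows "\<exists>C>0. \<forall>n\<ge>1. \<forall>f :: (nat \<Rightarrow> (real^'d) \<times> bool) \<Rightarrow> real^'d \<Rightarrow> bool.
    is_classifier n f \<longrightarrow>
      (SUP P\<in>P_Sigma' \<alpha> C0 \<beta> L c0 r0 \<mu>max K.
          ereal (expected_risk n P f - risk P (bayes_rule P)))
        \<ge> ereal (C * real n powr (- ((1 + \<alpha>) * \<beta> / ((2 + \<alpha>) * \<beta> + real CARD('d)))))"
proof -
  obtain A where A: "A \<subseteq> K" "compact A" "regular_set c0 r0 A" "\<mu>max * measure lborel A > 1"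
    using nondegenerate by (auto simp: measure_lebesgue_closed compact_imp_closed)
  then have clA: "closed A" by (simp add: compact_imp_closed)
  have "A \<noteq> {}" using A(4) by auto
  then obtain x0 where x0: "x0 \<in> A" by blast
  define D where "D = CARD('d)"
  have D: "D \<ge> 1" by (simp add: D_def Suc_leI)
  define v where "v = unit_ball_vol (real D)"
  have v: "v > 0" by (simp add: v_def)
  have reg: "c0 * (v * r ^ D) \<le> measure lborel (A \<inter> cball x r)" if "x \<in> A" "0 < r" "r \<le> r0" for x r
    using A(3) that clA
    by (auto simp: regular_set_def measure_lebesgue_closed closed_Int content_cball v_def D_def)
  obtain \<rho> where \<rho>: "0 < \<rho>" "\<rho> \<le> r0" "\<mu>max * measure lborel (A - cball x0 (2 * \<rho>)) \<ge> 1"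
    by (rule shrink_support[OF A(2) \<open>\<mu>max > 0\<close> A(4) \<open>r0 > 0\<close>])
  define \<kappa> where "\<kappa> = (3/4 :: real) ^ ((strict_floor \<beta> + 3) * CARD('d))"
  have \<kappa>: "\<kappa> > 0" by (simp add: \<kappa>_def)
  obtain CH where CH: "CH > 0" "\<forall>(c :: nat \<Rightarrow> real^'d) m \<delta> h L S. \<delta> > 0 \<longrightarrow> h \<ge> 0 \<longrightarrow>
      (\<forall>i<m. \<forall>j<m. i \<noteq> j \<longrightarrow> dist (c i) (c j) > 2 * real CARD('d) * \<delta>) \<longrightarrow>
      CH * h * (1 / \<delta>) powr \<beta> \<le> L \<longrightarrow>
    mixture m (\<lambda>j x. h * cube_bump (strict_floor \<beta> + 3) (1 / \<delta>) (- (1 / \<delta>) *\<^sub>R c j) x) S \<in> Hoelder_class \<beta> L"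
    using mixture_in_Hoelder_class[where 'd = 'd, OF \<open>\<beta> > 0\<close>] by blast
  \<comment> \<open>The bound 1/2 keeps the regression function in [0, 1]; the bound L / CH gives CH
    * h * \<delta>^(-\<beta>) = CH * h0 \<le> L at every scale.\<close>
  define h0 where "h0 = min (1/2) (L / CH)"
  have h0: "h0 > 0" "h0 \<le> 1/2" "CH * h0 \<le> L"
    using CH(1) \<open>L > 0\<close> by (auto simp: h0_def min_def field_simps)
  \<comment> \<open>\<open>g / \<delta> ^ D\<close> is the volume c0 * v * \<rho>^D that regularity
    guarantees around x0, divided by the volume of a ball of radius 2 * D * \<delta>: the number of
    centres within reach of the packing argument.\<close>
  define g where "g = c0 * \<rho> ^ D / (2 * real D) ^ D"
  have g: "g > 0" using \<rho> \<open>c0 > 0\<close> D by (simp add: g_def)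
  \<comment> \<open>The four bounds serve the indistinguishability of sign patterns, the density bound, the total
    mass, and the margin condition.\<close>
  define w0 where "w0 = min (min (1/10) (\<mu>max * c0 * v / 2 ^ D)) (min (2 / g) (2 * C0 * (\<kappa> * h0) powr \<alpha> / g))"
  have w0: "w0 > 0" "w0 \<le> 1/10" "w0 \<le> \<mu>max * c0 * v / 2 ^ D" "g * w0 / 2 \<le> 1" "g * w0 / 2 \<le> C0 * (\<kappa> * h0) powr \<alpha>"
  proof -
    show "w0 > 0" using assms v g \<kappa> h0 by (simp add: w0_def)
    show "w0 \<le> 1/10" "w0 \<le> \<mu>max * c0 * v / 2 ^ D"
      unfolding w0_def by (meson min.cobounded1 min.cobounded2 order_trans)+
    have "w0 \<le> 2 / g" "w0 \<le> 2 * C0 * (\<kappa> * h0) powr \<alpha> / g"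
      unfolding w0_def by (meson min.cobounded1 min.cobounded2 order_trans)+
    then show "g * w0 / 2 \<le> 1" "g * w0 / 2 \<le> C0 * (\<kappa> * h0) powr \<alpha>"
      using g by (simp_all add: pos_le_divide_eq mult.commute)
  qed
  \<comment> \<open>The bound 1 makes powers of the scale monotone, \<rho> / D keeps every cube
    inside the removed ball, and g / 4 makes \<open>g / \<delta> ^ D\<close> at least 4, so that
    rounding is harmless.\<close>
  define \<delta>0 where "\<delta>0 = min (min 1 (\<rho> / real D)) (g / 4)"
  have \<delta>0: "\<delta>0 > 0" "\<delta>0 \<le> 1" "\<delta>0 \<le> \<rho> / real D" "\<delta>0 \<le> g / 4"
  proof -
    show "\<delta>0 > 0" using \<rho> g D by (simp add: \<delta>0_def)
    show "\<delta>0 \<le> 1" "\<delta>0 \<le> \<rho> / real D" "\<delta>0 \<le> g / 4"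
      unfolding \<delta>0_def by (meson min.cobounded1 min.cobounded2 order_trans)+
  qed
  define e where "e = (2 + \<alpha>) * \<beta> + real D"
  have e: "e > 0" using assms by (simp add: e_def add_pos_nonneg)
  \<comment> \<open>The factor 1/8 is the 1/2 of the averaging argument times the 1/4 in the lower
    bound on m.\<close>
  define C where "C = g * \<kappa> * h0 * w0 / 8 * \<delta>0 powr ((1 + \<alpha>) * \<beta>)"
  have C: "C > 0" using g \<kappa> h0 w0 \<delta>0 by (simp add: C_def)
  have "ereal (C * real n powr (- ((1 + \<alpha>) * \<beta> / e))) \<le>
      (SUP P\<in>P_Sigma' \<alpha> C0 \<beta> L c0 r0 \<mu>max K. ereal (expected_risk n P f - risk P (bayes_rule P)))"
    if n: "n \<ge> 1" and f: "is_classifier n f" for n and f :: "(nat \<Rightarrow> (real^'d) \<times> bool) \<Rightarrow> real^'d \<Rightarrow> bool"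
  proof -
    \<comment> \<open>This scale makes \<open>n * \<delta> powr e\<close>, hence the information \<open>n * h\<^sup>2 * \<omega>\<close> per bump, bounded in \<open>n\<close>.\<close>
    define \<delta> where "\<delta> = \<delta>0 * real n powr (- 1 / e)"
    have "real n powr (- 1 / e) \<le> real n powr 0"
      using n e by (intro powr_mono) auto
    then have \<delta>_le: "\<delta> \<le> \<delta>0"
      using \<delta>0 n by (simp add: \<delta>_def mult_left_le)
    have \<delta>: "\<delta> > 0" "\<delta> \<le> 1" "\<delta> \<le> \<rho> / real D"
    proof -
      show "\<delta> > 0" using \<delta>0 n by (simp add: \<delta>_def)
      show "\<delta> \<le> 1" "\<delta> \<le> \<rho> / real D" using \<delta>_le \<delta>0 by linarith+
    qed
    have D\<delta>: "real D * \<delta> \<le> \<rho>" using \<delta>(3) D by (simp add: field_simps)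
    have "1 * \<delta> \<le> real D * \<delta>" using D \<delta> by (intro mult_right_mono) auto
    then have \<delta>_r0: "\<delta> / 2 \<le> r0" using D\<delta> \<rho> \<delta> by linarith
    \<comment> \<open>Up to a constant factor t is h^\<alpha>, since h is
      \<open>h0 * \<delta> powr \<beta>\<close>.\<close>
    define t where "t = \<delta> powr (\<alpha> * \<beta>)"
    have t: "0 < t" "t \<le> 1"
      using \<delta> assms powr_mono2[of "\<alpha> * \<beta>" \<delta> 1] by (simp_all add: t_def)
    define h where "h = h0 * \<delta> powr \<beta>"
    have b1: "0 < \<delta> powr \<beta>" "\<delta> powr \<beta> \<le> 1"
      using \<delta> assms powr_mono2[of \<beta> \<delta> 1] by simp_all
    have h: "0 < h" "h \<le> 1/2"
      using h0 b1 mult_mono[of h0 "1/2" "\<delta> powr \<beta>" 1] by (auto simp: h_def)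
    define \<omega> where "\<omega> = w0 * (\<delta> ^ D * t)"
    have \<omega>: "\<omega> > 0" using w0 \<delta> t by (simp add: \<omega>_def)
    \<comment> \<open>Halving the quotient leaves the strict inequality that the packing needs; as
      the quotient is at least 4, rounding down still keeps a quarter of it.\<close>
    define m where "m = nat \<lfloor>g / \<delta> ^ D / 2\<rfloor>"
    have "\<delta> ^ D \<le> \<delta> ^ 1" using \<delta> D by (intro power_decreasing) auto
    then have "\<delta> ^ D \<le> g / 4" using \<delta>_le \<delta>0 by simp
    then have G: "1 \<le> g / \<delta> ^ D / 4"
      using \<delta> by (simp add: field_simps)
    have m: "real m \<le> g / \<delta> ^ D / 2" "g / \<delta> ^ D / 4 \<le> real m"
      using G by (simp_all add: m_def) linarith+
    have m\<omega>: "real m * \<omega> \<le> g * w0 / 2 * t" "g * w0 / 4 * t \<le> real m * \<omega>"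
      using mult_right_mono[OF m(1), of \<omega>] mult_right_mono[OF m(2), of \<omega>] \<omega> \<delta>
      by (simp_all add: \<omega>_def)
    \<comment> \<open>The centres are taken in A itself, so regularity applies to the small balls
      around them.\<close>
    have "\<exists>c :: nat \<Rightarrow> real^'d. (\<forall>j<m. c j \<in> A \<inter> cball x0 \<rho>) \<and>
        (\<forall>i<m. \<forall>j<m. i \<noteq> j \<longrightarrow> dist (c i) (c j) > 2 * real CARD('d) * \<delta>)"
    proof (rule packing)
      have "real m * (v * (2 * real D * \<delta>) ^ D) \<le> g / \<delta> ^ D / 2 * (v * (2 * real D * \<delta>) ^ D)"
        using m(1) v \<delta> by (intro mult_right_mono) auto
      also have "\<dots> = c0 * (v * \<rho> ^ D) / 2"
        using \<delta> D by (simp add: g_def power_mult_distrib)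
      also have "\<dots> < c0 * (v * \<rho> ^ D)" using \<rho> v \<open>c0 > 0\<close> by simp
      also have "\<dots> \<le> measure lborel (A \<inter> cball x0 \<rho>)" using reg[OF x0] \<rho> by simp
      finally show "real m * (unit_ball_vol CARD('d) * (2 * real CARD('d) * \<delta>) ^ CARD('d)) < measure lborel (A \<inter> cball x0 \<rho>)"
        by (simp add: v_def D_def)
    qed (use clA \<delta> in \<open>auto intro: closed_Int\<close>)
    then obtain c :: "nat \<Rightarrow> real^'d" where c: "\<And>j. j < m \<Longrightarrow> c j \<in> A" "\<And>j. j < m \<Longrightarrow> c j \<in> cball x0 \<rho>"
      "\<And>i j. i < m \<Longrightarrow> j < m \<Longrightarrow> i \<noteq> j \<Longrightarrow> dist (c i) (c j) > 2 * real CARD('d) * \<delta>"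
      by blast
    have "\<exists>P\<in>P_Sigma' \<alpha> C0 \<beta> L c0 r0 \<mu>max K.
      expected_risk n P f - risk P (bayes_rule P) \<ge> 1/2 * (real m * (\<kappa> * h * \<omega>))"
      unfolding \<kappa>_def
    proof (rule lower_bound_configuration[where \<delta> = \<delta> and c = c and ?x0.0 = x0 and \<rho> = \<rho> and L = L])
      show "real CARD('d) * \<delta> \<le> \<rho>" using D\<delta> by (simp add: D_def)
      have "g * w0 / 2 * t \<le> 1 * 1"
        using w0 g t by (intro mult_mono) auto
      then show "real m * \<omega> \<le> 1" using m\<omega> by simp
      have "g * w0 / 2 * t \<le> C0 * (\<kappa> * h0) powr \<alpha> * t"
        using w0 t by (intro mult_right_mono) auto
      also have "\<dots> = C0 * (\<kappa> * h) powr \<alpha>"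
        using \<kappa> h0 \<delta> by (simp add: h_def t_def powr_mult powr_powr mult.commute)
      finally show "real m * \<omega> \<le> C0 * ((3/4) ^ ((strict_floor \<beta> + 3) * CARD('d)) * h) powr \<alpha>"
        using m\<omega> by (simp add: \<kappa>_def)
      show "\<omega> \<le> \<mu>max * measure lborel (A \<inter> cball (c j) (\<delta> / 2))" if j: "j < m" for j
      proof -
        have "\<omega> \<le> w0 * (\<delta> ^ D * 1)"
          unfolding \<omega>_def using w0 t \<delta> by (intro mult_left_mono) auto
        also have "\<dots> \<le> \<mu>max * c0 * v / 2 ^ D * (\<delta> ^ D * 1)"
          using w0 \<delta> by (intro mult_right_mono) auto
        also have "\<dots> = \<mu>max * (c0 * (v * (\<delta> / 2) ^ D))"
          by (simp add: power_divide)
        also have "\<dots> \<le> \<mu>max * measure lborel (A \<inter> cball (c j) (\<delta> / 2))"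
          using reg[OF c(1)[OF j], of "\<delta> / 2"] \<delta> \<delta>_r0 \<open>\<mu>max > 0\<close> by (intro mult_left_mono) auto
        finally show ?thesis .
      qed
      show "(1 + 4 * (h\<^sup>2 * \<omega>)) ^ n \<le> 9/8"
      proof -
        \<comment> \<open>The exponents 2\<beta>, D and \<alpha>\<beta> of h^2, the cell volume and
          t add up to e.\<close>
        have "\<delta> powr \<beta> * \<delta> powr \<beta> * (\<delta> ^ D * t) = \<delta> powr e"
          using \<delta> by (simp add: t_def e_def powr_realpow[symmetric] powr_add[symmetric] algebra_simps)
        also have "\<dots> = \<delta>0 powr e * (real n powr (- 1 / e)) powr e"
          using \<delta>0 by (simp add: \<delta>_def powr_mult)
        also have "(real n powr (- 1 / e)) powr e = 1 / real n"
        proof -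
          have "(real n powr (- 1 / e)) powr e = real n powr (- 1 / e * e)" by (rule powr_powr)
          also have "- 1 / e * e = - 1" using e by simp
          finally show ?thesis using n by (simp add: powr_minus_divide)
        qed
        finally have "real n * (\<delta> powr \<beta> * \<delta> powr \<beta> * (\<delta> ^ D * t)) = \<delta>0 powr e"
          using n by simp
        also have "\<dots> \<le> 1" using \<delta>0 e powr_mono2[of e \<delta>0 1] by simp
        finally have nd: "real n * (\<delta> powr \<beta> * \<delta> powr \<beta> * (\<delta> ^ D * t)) \<le> 1" .
        have "real n * (4 * (h\<^sup>2 * \<omega>)) = 4 * h0\<^sup>2 * w0 * (real n * (\<delta> powr \<beta> * \<delta> powr \<beta> * (\<delta> ^ D * t)))"
          by (simp add: h_def \<omega>_def power2_eq_square)
        also have "\<dots> \<le> 4 * h0\<^sup>2 * w0 * 1"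
          using nd w0 by (intro mult_left_mono) auto
        also have "\<dots> \<le> 1 * (1/10)"
        proof -
          have "h0\<^sup>2 \<le> (1/2)\<^sup>2" using h0 by (intro power_mono) auto
          then have "4 * h0\<^sup>2 \<le> 1" by (simp add: power2_eq_square)
          then show ?thesis unfolding mult_1_right using w0 by (intro mult_mono) auto
        qed
        finally have y: "real n * (4 * (h\<^sup>2 * \<omega>)) \<le> 1/10" by simp
        \<comment> \<open>The bound 1/10 on w0 is made for this: exp (1/10) \<le> 1 + 1/10 + 1/100 <
          9/8.\<close>
        have "(1 + 4 * (h\<^sup>2 * \<omega>)) ^ n \<le> exp (4 * (h\<^sup>2 * \<omega>)) ^ n"
          using \<omega> by (intro power_mono exp_ge_add_one_self) (simp add: add_nonneg_nonneg)
        also have "\<dots> = exp (real n * (4 * (h\<^sup>2 * \<omega>)))"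
          by (simp add: exp_of_nat_mult)
        also have "\<dots> \<le> exp (1/10)" using y by simp
        also have "\<dots> \<le> 1 + 1/10 + (1/10)\<^sup>2" by (rule exp_bound) auto
        also have "\<dots> \<le> 9/8" by (simp add: power2_eq_square)
        finally show ?thesis .
      qed
      have "CH * h * (1 / \<delta>) powr \<beta> = CH * h0"
        using \<delta> by (simp add: h_def powr_divide)
      then show "mixture m (\<lambda>j x. h * cube_bump (strict_floor \<beta> + 3) (1 / \<delta>) (- (1 / \<delta>) *\<^sub>R c j) x) S
          \<in> Hoelder_class \<beta> L" for S
        using \<delta> h h0 c(3) by (intro CH(2)[rule_format]) auto
    qed (use A \<rho> \<delta> c \<omega> h f assms in auto)
    then obtain P where P: "P \<in> P_Sigma' \<alpha> C0 \<beta> L c0 r0 \<mu>max K"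
      "expected_risk n P f - risk P (bayes_rule P) \<ge> 1/2 * (real m * (\<kappa> * h * \<omega>))"
      by blast
    have "C * real n powr (- ((1 + \<alpha>) * \<beta> / e)) =
        g * \<kappa> * h0 * w0 / 8 * (\<delta>0 powr ((1 + \<alpha>) * \<beta>) * (real n powr (- 1 / e)) powr ((1 + \<alpha>) * \<beta>))"
      by (simp add: C_def powr_powr)
    also have "\<delta>0 powr ((1 + \<alpha>) * \<beta>) * (real n powr (- 1 / e)) powr ((1 + \<alpha>) * \<beta>) = \<delta> powr ((1 + \<alpha>) * \<beta>)"
      using \<delta>0 by (simp add: \<delta>_def powr_mult)
    also have "\<dots> = \<delta> powr \<beta> * t"
      by (simp add: t_def powr_add[symmetric] algebra_simps)
    also have "g * \<kappa> * h0 * w0 / 8 * (\<delta> powr \<beta> * t) = 1/2 * (\<kappa> * h) * (g * w0 / 4 * t)"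
      by (simp add: h_def)
    also have "\<dots> \<le> 1/2 * (\<kappa> * h) * (real m * \<omega>)"
      using m\<omega>(2) \<kappa> h by (intro mult_left_mono) auto
    also have "\<dots> = 1/2 * (real m * (\<kappa> * h * \<omega>))" by simp
    also note P(2)
    finally show ?thesis
      using P(1) by (intro SUP_upper2[of P]) auto
  qed
  then show ?thesis
    using C unfolding e_def D_def by blast
qed

end
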